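(* Let $n\ge4$, and assume the Iarrobino-Kanev conjecture (as stated in the context). Then $p(n,2d)$ grows asymptotically like $d^{(n-1)/2}$ for $d\to\infty$. More precisely, for any $\epsilon>0$ the inequalities $$(c_n-\epsilon)\,d^{(n-1)/2}\;<\;p(n,2d)\;<\;(C_n+\epsilon)\,d^{(n-1)/2}$$ hold for all but finitely many positive integers $d$, where $$c_n=\sqrt{\frac{2^n-2n}{(n-1)!}},\qquad C_n=\sqrt{\frac{2^n}{(n-1)!}}.$$
   Context: For $n\ge1$, $e\ge0$ let $\mathbb{R}[\mathtt{x}]_e$ denote the space of forms of degree $e$ in $\mathbb{R}[\mathtt{x}]=\mathbb{R}[x_1,\dots,x_n]$, and write $N_e=N_{n,e}=\dim\mathbb{R}[\mathtt{x}]_e=\binom{n+e-1}{n-1}$. Let $\Sigma_{n,2d}\subseteq\mathbb{R}[\mathtt{x}]_{2d}$ be the set of forms of degree $2d$ that are finite sums of squares of forms in $\mathbb{R}[\mathtt{x}]_d$. For $f\in\Sigma_{n,2d}$ the sos length $\ell(f)$ is the smallest $r\ge0$ such that $f=p_1^2+\cdots+p_r^2$ for some $p_1,\dots,p_r\in\mathbb{R}[\mathtt{x}]_d$, and $p(n,2d)=\sup\{\ell(f)\colon f\in\Sigma_{n,2d}\}$. For a homogeneous ideal $I\subseteq\mathbb{R}[\mathtt{x}]$ write $h_j(I)=\dim\mathbb{R}[\mathtt{x}]_j/I_j$. For a set $Z\subseteq\mathbb{P}^{n-1}(\mathbb{R})$ let $I(Z)$ be its full (saturated) homogeneous vanishing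 ideal. A statement holds for "a set of $s$ general points" if it holds for all $s$-tuples of points in a nonempty Zariski open subset of $(\mathbb{P}^{n-1})^s$. Iarrobino-Kanev conjecture: Let $n\ge3$, $d\ge2$ and $N_{d-1}\le s<N_d$, and let $I=I(Z)$ be the vanishing ideal of a set $Z$ of $s$ general points in $\mathbb{P}^{n-1}$. Then $$h_{2d}(I^2)=\max\Bigl\{ns,\;N_{2d}-\binom{N_d-s+1}{2}\Bigr\},$$ except for $(n,d,s)=(3,2,5)$, $(4,2,9)$ and $(5,2,14)$, where $\max$ has to be replaced by $\min$. *)

theory Defs
  imports
    "HOL-Library.Poly_Mapping"
    "HOL-Library.FuncSet"
    "HOL-Library.Extended_Real"
    "HOL-Library.Landau_Symbols"
    "HOL-Algebra.Ideal_Product"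
begin

section \<open>Forms in finitely many variables\<close>

text \<open>
  A monomial is an exponent vector \<^typ>\<open>'v \<Rightarrow>\<^sub>0 nat\<close>, a polynomial a finitely supported family of
  real coefficients indexed by monomials.  The variables of \<open>\<real>[x\<^sub>1,\<dots>,x\<^sub>n]\<close> are numbered
  \<open>0,\<dots>,n-1\<close>.
\<close>

type_synonym 'v mpoly = "('v \<Rightarrow>\<^sub>0 nat) \<Rightarrow>\<^sub>0 real"

definition mpoly_eval :: "('v \<Rightarrow> real) \<Rightarrow> 'v mpoly \<Rightarrow> real" where
  "mpoly_eval x p =
     (\<Sum>m\<in>Poly_Mapping.keys p. Poly_Mapping.lookup p m *
        (\<Prod>v\<in>Poly_Mapping.keys m. x v ^ Poly_Mapping.lookup m v))"

definition mpoly_scale :: "real \<Rightarrow> 'v mpoly \<Rightarrow> 'v mpoly" where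
  "mpoly_scale c p = Poly_Mapping.single 0 c * p"

definition mpoly_ring :: "nat \<Rightarrow> nat mpoly ring" where
  "mpoly_ring n =
     \<lparr>carrier = {p. \<forall>m\<in>Poly_Mapping.keys p. Poly_Mapping.keys m \<subseteq> {..<n}},
      monoid.mult = (*), one = 1, ring.zero = 0, add = (+)\<rparr>"

definition forms :: "nat \<Rightarrow> nat \<Rightarrow> nat mpoly set" where
  "forms n e = {p \<in> carrier (mpoly_ring n).
     \<forall>m\<in>Poly_Mapping.keys p. (\<Sum>i<n. Poly_Mapping.lookup m i) = e}"

text \<open>The number \<open>N\<^bsub>n,e\<^esub>\<close>, i.e. the dimension of \<^term>\<open>forms n e\<close> (for \<open>n \<ge> 1\<close>).\<close>

definition num_forms :: "nat \<Rightarrow> nat \<Rightarrow> nat" where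
  "num_forms n e = (n + e - 1) choose (n - 1)"


section \<open>Sums of squares\<close>

text \<open>In this section the second argument is \<open>d\<close>, where the forms have degree \<open>2d\<close>.\<close>

definition is_sos_of_length :: "nat \<Rightarrow> nat \<Rightarrow> nat mpoly \<Rightarrow> nat \<Rightarrow> bool" where
  "is_sos_of_length n d f r \<longleftrightarrow>
     (\<exists>p :: nat \<Rightarrow> nat mpoly. (\<forall>i<r. p i \<in> forms n d) \<and> f = (\<Sum>i<r. (p i)\<^sup>2))"

definition sos_forms :: "nat \<Rightarrow> nat \<Rightarrow> nat mpoly set" where
  "sos_forms n d = {f \<in> forms n (2 * d). \<exists>r. is_sos_of_length n d f r}"

definition sos_length :: "nat \<Rightarrow> nat \<Rightarrow> nat mpoly \<Rightarrow> nat" where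
  "sos_length n d f = (LEAST r. is_sos_of_length n d f r)"

text \<open>
  \<open>p(n,2d)\<close>; taken in \<^typ>\<open>enat\<close>, since a supremum in \<^typ>\<open>nat\<close> would be meaningless for an
  unbounded set of lengths.
\<close>

definition pythagoras :: "nat \<Rightarrow> nat \<Rightarrow> enat" where
  "pythagoras n d = (SUP f\<in>sos_forms n d. enat (sos_length n d f))"


section \<open>Hilbert functions\<close>

text \<open>
  \<^term>\<open>B\<close> represents a basis of \<open>V / W\<close>: every class in \<open>V / W\<close> is a unique linear combination
  of the classes of the elements of \<^term>\<open>B\<close>.
\<close>

definition quotient_basis :: "'v mpoly set \<Rightarrow> 'v mpoly set \<Rightarrow> 'v mpoly set \<Rightarrow> bool" where
  "quotient_basis V W B \<longleftrightarrow> finite B \<and> B \<subseteq> V \<and>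
     (\<forall>v\<in>V. \<exists>!c. c \<in> B \<rightarrow>\<^sub>E UNIV \<and> v - (\<Sum>b\<in>B. mpoly_scale (c b) b) \<in> W)"

definition quotient_dim :: "'v mpoly set \<Rightarrow> 'v mpoly set \<Rightarrow> nat" where
  "quotient_dim V W = (THE k. \<exists>B. quotient_basis V W B \<and> card B = k)"

definition hilbert_function :: "nat \<Rightarrow> nat mpoly set \<Rightarrow> nat \<Rightarrow> nat" where
  "hilbert_function n I j = quotient_dim (forms n j) (I \<inter> forms n j)"


section \<open>Points of real projective space and general tuples\<close>

text \<open>
  A point of \<open>\<PP>\<^sup>n\<^sup>-\<^sup>1(\<real>)\<close> is the set of all its homogeneous coordinate vectors; vectors of
  \<open>\<real>\<^sup>n\<close> are functions vanishing outside \<^term>\<open>{..<n}\<close>.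
\<close>

definition proj_space :: "nat \<Rightarrow> (nat \<Rightarrow> real) set set" where
  "proj_space n =
     {{(\<lambda>i. c * v i) | c. c \<noteq> 0} | v. (\<forall>i\<ge>n. v i = 0) \<and> v \<noteq> (\<lambda>_. 0)}"

definition vanishing_ideal :: "nat \<Rightarrow> (nat \<Rightarrow> real) set set \<Rightarrow> nat mpoly set" where
  "vanishing_ideal n Z = genideal (mpoly_ring n)
     {f. (\<exists>e. f \<in> forms n e) \<and> (\<forall>P\<in>Z. \<forall>x\<in>P. mpoly_eval x f = 0)}"

definition proj_tuples :: "nat \<Rightarrow> nat \<Rightarrow> (nat \<Rightarrow> (nat \<Rightarrow> real) set) set" where
  "proj_tuples n s = {..<s} \<rightarrow>\<^sub>E proj_space n"

text \<open>
  Multihomogeneous polynomials in \<open>s\<close> groups of \<open>n\<close> variables; the variable \<open>(i, j)\<close> is the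
  \<open>j\<close>-th homogeneous coordinate of the \<open>i\<close>-th point.
\<close>

definition multiforms :: "nat \<Rightarrow> nat \<Rightarrow> (nat \<times> nat) mpoly set" where
  "multiforms n s = {f. \<exists>a :: nat \<Rightarrow> nat. \<forall>m\<in>Poly_Mapping.keys f.
     Poly_Mapping.keys m \<subseteq> {..<s} \<times> {..<n} \<and>
     (\<forall>i<s. (\<Sum>j<n. Poly_Mapping.lookup m (i, j)) = a i)}"

definition zariski_closed_tuples ::
    "nat \<Rightarrow> nat \<Rightarrow> (nat \<Rightarrow> (nat \<Rightarrow> real) set) set \<Rightarrow> bool" where
  "zariski_closed_tuples n s C \<longleftrightarrow>
     (\<exists>F \<subseteq> multiforms n s. C = {P \<in> proj_tuples n s.
        \<forall>f\<in>F. \<forall>x. (\<forall>i<s. x i \<in> P i) \<longrightarrow> mpoly_eval (\<lambda>(i, j). x i j) f = 0})"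

definition zariski_open_tuples ::
    "nat \<Rightarrow> nat \<Rightarrow> (nat \<Rightarrow> (nat \<Rightarrow> real) set) set \<Rightarrow> bool" where
  "zariski_open_tuples n s U \<longleftrightarrow>
     U \<subseteq> proj_tuples n s \<and> zariski_closed_tuples n s (proj_tuples n s - U)"

definition for_general_points ::
    "nat \<Rightarrow> nat \<Rightarrow> ((nat \<Rightarrow> real) set set \<Rightarrow> bool) \<Rightarrow> bool" where
  "for_general_points n s Q \<longleftrightarrow>
     (\<exists>U. zariski_open_tuples n s U \<and> U \<noteq> {} \<and> (\<forall>P\<in>U. Q (P ` {..<s})))"


section \<open>The Iarrobino--Kanev conjecture\<close>

text \<open>The right-hand side is an integer since \<open>N\<^bsub>2d\<^esub> - \<dots>\<close> may be negative.\<close>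

definition iarrobino_kanev_value :: "nat \<Rightarrow> nat \<Rightarrow> nat \<Rightarrow> int" where
  "iarrobino_kanev_value n d s =
     (let a = int (n * s);
          b = int (num_forms n (2 * d)) - int ((num_forms n d - s + 1) choose 2)
      in if (n, d, s) \<in> {(3, 2, 5), (4, 2, 9), (5, 2, 14)} then min a b else max a b)"

definition iarrobino_kanev_conjecture :: bool where
  "iarrobino_kanev_conjecture \<longleftrightarrow>
     (\<forall>n d s. 3 \<le> n \<longrightarrow> 2 \<le> d \<longrightarrow> num_forms n (d - 1) \<le> s \<longrightarrow> s < num_forms n d \<longrightarrow>
        for_general_points n s (\<lambda>Z.
          int (hilbert_function n
                (ideal_prod (mpoly_ring n) (vanishing_ideal n Z) (vanishing_ideal n Z)) (2 * d))
          = iarrobino_kanev_value n d s))"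


section \<open>Well-definedness\<close>

lemma keys_mult_vars:
  fixes p q :: "'v mpoly"
  assumes "\<forall>m\<in>Poly_Mapping.keys p. Poly_Mapping.keys m \<subseteq> A"
    and "\<forall>m\<in>Poly_Mapping.keys q. Poly_Mapping.keys m \<subseteq> A"
  shows "\<forall>m\<in>Poly_Mapping.keys (p * q). Poly_Mapping.keys m \<subseteq> A"
proof
  fix m assume "m \<in> Poly_Mapping.keys (p * q)"
  then obtain a b where "a \<in> Poly_Mapping.keys p" "b \<in> Poly_Mapping.keys q" "m = a + b"
    using keys_mult[of p q] by auto
  then show "Poly_Mapping.keys m \<subseteq> A"
    using assms Poly_Mapping.keys_add[of a b] by blast
qed

lemma cring_mpoly_ring: "cring (mpoly_ring n)"
proof (rule cringI)
  show "abelian_group (mpoly_ring n)"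
  proof (rule abelian_groupI)
    fix x y assume "x \<in> carrier (mpoly_ring n)" "y \<in> carrier (mpoly_ring n)"
    then show "x \<oplus>\<^bsub>mpoly_ring n\<^esub> y \<in> carrier (mpoly_ring n)"
      using Poly_Mapping.keys_add[of x y] by (auto simp: mpoly_ring_def)
  next
    fix x assume "x \<in> carrier (mpoly_ring n)"
    then show "\<exists>y\<in>carrier (mpoly_ring n). y \<oplus>\<^bsub>mpoly_ring n\<^esub> x = \<zero>\<^bsub>mpoly_ring n\<^esub>"
      by (intro bexI[of _ "- x"]) (auto simp: mpoly_ring_def)
  qed (auto simp: mpoly_ring_def algebra_simps)
  show "comm_monoid (mpoly_ring n)"
  proof (rule comm_monoidI)
    fix x y assume "x \<in> carrier (mpoly_ring n)" "y \<in> carrier (mpoly_ring n)"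
    then show "x \<otimes>\<^bsub>mpoly_ring n\<^esub> y \<in> carrier (mpoly_ring n)"
      using keys_mult_vars[of x "{..<n}" y] by (simp add: mpoly_ring_def)
  qed (auto simp: mpoly_ring_def algebra_simps)
qed (auto simp: mpoly_ring_def algebra_simps)

global_interpretation mpoly: vector_space mpoly_scale
proof
  fix a b :: real and x y :: "'v mpoly"
  show "mpoly_scale a (x + y) = mpoly_scale a x + mpoly_scale a y"
    by (simp add: mpoly_scale_def algebra_simps)
  show "mpoly_scale (a + b) x = mpoly_scale a x + mpoly_scale b x"
    by (simp add: mpoly_scale_def single_add algebra_simps)
  show "mpoly_scale a (mpoly_scale b x) = mpoly_scale (a * b) x"
    by (simp add: mpoly_scale_def mult_single flip: mult.assoc)
  show "mpoly_scale 1 x = x"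
    by (simp add: mpoly_scale_def)
qed

lemma quotient_basis_card:
  fixes V W B :: "'v mpoly set"
  assumes W: "mpoly.subspace W" and V: "mpoly.subspace V" and "W \<subseteq> V"
    and fin: "finite T" "V \<subseteq> mpoly.span T"
    and B: "quotient_basis V W B"
  shows "card B + mpoly.dim W = mpoly.dim V"
proof -
  obtain A where A: "A \<subseteq> W" "mpoly.independent A" "W \<subseteq> mpoly.span A" "card A = mpoly.dim W"
    by (rule mpoly.basis_exists)
  have finA: "finite A"
    using mpoly.independent_span_bound[OF fin(1) A(2)] A(1) \<open>W \<subseteq> V\<close> fin(2) by blast
  have finB: "finite B" and BV: "B \<subseteq> V" using B by (auto simp: quotient_basis_def)
  have spA: "mpoly.span A = W"
    using A W by (simp add: mpoly.span_subspace)
  have indep: "c b = 0" if "(\<Sum>b\<in>B. mpoly_scale (c b) b) \<in> W" "b \<in> B" for c b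
  proof -
    have "0 \<in> V" using V mpoly.subspace_0 by blast
    then have ex1: "\<exists>!c. c \<in> B \<rightarrow>\<^sub>E UNIV \<and> 0 - (\<Sum>b\<in>B. mpoly_scale (c b) b) \<in> W"
      using B unfolding quotient_basis_def by blast
    have 1: "restrict c B \<in> B \<rightarrow>\<^sub>E UNIV \<and> 0 - (\<Sum>b\<in>B. mpoly_scale (restrict c B b) b) \<in> W"
      using mpoly.subspace_neg[OF W that(1)] by (simp cong: sum.cong)
    have 2: "restrict (\<lambda>_. 0) B \<in> B \<rightarrow>\<^sub>E UNIV \<and>
        0 - (\<Sum>b\<in>B. mpoly_scale (restrict (\<lambda>_. 0) B b) b) \<in> W"
      using mpoly.subspace_0[OF W] by (simp cong: sum.cong)
    have "restrict c B = restrict (\<lambda>_. 0) B"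
    proof -
      define P where "P c \<longleftrightarrow> c \<in> B \<rightarrow>\<^sub>E UNIV \<and> 0 - (\<Sum>b\<in>B. mpoly_scale (c b) b) \<in> W" for c
      have "\<exists>!c. P c" "P (restrict c B)" "P (restrict (\<lambda>_. 0) B)"
        unfolding P_def by (fact ex1 1 2)+
      then show ?thesis by blast
    qed
    then show ?thesis using that(2) by (auto dest: fun_cong[of _ _ b])
  qed
  have disj: "A \<inter> B = {}"
  proof (rule ccontr)
    assume "A \<inter> B \<noteq> {}"
    then obtain b where b: "b \<in> A" "b \<in> B" by auto
    have "(\<Sum>x\<in>B. mpoly_scale (if x = b then 1 else 0) x) = (\<Sum>x\<in>B. if x = b then x else 0)"
      by (rule sum.cong) auto
    also have "\<dots> = b" using b finB by simp
    finally have "(\<Sum>x\<in>B. mpoly_scale (if x = b then 1 else 0) x) \<in> W" using b A by auto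
    from indep[OF this b(2)] show False by simp
  qed
  have ind: "mpoly.independent (A \<union> B)"
  proof (rule mpoly.independent_if_scalars_zero)
    show "finite (A \<union> B)" using finA finB by simp
    fix f x assume 0: "(\<Sum>x\<in>A \<union> B. mpoly_scale (f x) x) = 0" and x: "x \<in> A \<union> B"
    have s: "(\<Sum>x\<in>A. mpoly_scale (f x) x) + (\<Sum>x\<in>B. mpoly_scale (f x) x) = 0"
      using 0 finA finB disj by (simp add: sum.union_disjoint)
    have "(\<Sum>x\<in>A. mpoly_scale (f x) x) \<in> W"
      using A W by (intro mpoly.subspace_sum mpoly.subspace_scale) auto
    moreover have "(\<Sum>x\<in>B. mpoly_scale (f x) x) = - (\<Sum>x\<in>A. mpoly_scale (f x) x)"
      using s by (simp only: add_eq_0_iff)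
    ultimately have "(\<Sum>x\<in>B. mpoly_scale (f x) x) \<in> W"
      using mpoly.subspace_neg[OF W] by simp
    then have fB: "f b = 0" if "b \<in> B" for b using that by (rule indep[of f])
    then have "(\<Sum>x\<in>A. mpoly_scale (f x) x) = 0" using s by (simp cong: sum.cong)
    then have "f a = 0" if "a \<in> A" for a
      by (rule mpoly.independentD[OF A(2) finA subset_refl _ that])
    then show "f x = 0" using x fB by auto
  qed
  have span: "V \<subseteq> mpoly.span (A \<union> B)"
  proof
    fix v assume "v \<in> V"
    then have "\<exists>!c. c \<in> B \<rightarrow>\<^sub>E UNIV \<and> v - (\<Sum>b\<in>B. mpoly_scale (c b) b) \<in> W"
      using B unfolding quotient_basis_def by blast
    then obtain c where "v - (\<Sum>b\<in>B. mpoly_scale (c b) b) \<in> W"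
      by (elim ex1E conjE)
    then have "v - (\<Sum>b\<in>B. mpoly_scale (c b) b) \<in> mpoly.span (A \<union> B)"
      using spA mpoly.span_mono[of A "A \<union> B"] by auto
    moreover have "(\<Sum>b\<in>B. mpoly_scale (c b) b) \<in> mpoly.span (A \<union> B)"
      by (intro mpoly.span_sum mpoly.span_scale mpoly.span_base) auto
    ultimately have "v - (\<Sum>b\<in>B. mpoly_scale (c b) b) + (\<Sum>b\<in>B. mpoly_scale (c b) b)
        \<in> mpoly.span (A \<union> B)"
      by (rule mpoly.span_add)
    then show "v \<in> mpoly.span (A \<union> B)" by simp
  qed
  have "card (A \<union> B) = mpoly.dim V"
    using mpoly.basis_card_eq_dim[OF _ span ind] A(1) BV \<open>W \<subseteq> V\<close> by blast
  then show ?thesis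
    using A(4) finA finB disj by (simp add: card_Un_disjoint)
qed

lemma quotient_basis_exists:
  fixes V W :: "'v mpoly set"
  assumes W: "mpoly.subspace W" and V: "mpoly.subspace V" and "W \<subseteq> V"
    and fin: "finite T" "V \<subseteq> mpoly.span T"
  obtains B where "quotient_basis V W B"
proof -
  obtain A where A: "A \<subseteq> W" "mpoly.independent A" "W \<subseteq> mpoly.span A"
    by (rule mpoly.maximal_independent_subset)
  have "A \<subseteq> V" using A(1) \<open>W \<subseteq> V\<close> by blast
  then obtain C where C: "A \<subseteq> C" "C \<subseteq> V" "mpoly.independent C" "V \<subseteq> mpoly.span C"
    using mpoly.maximal_independent_subset_extend A(2) by blast
  have finC: "finite C"
    using mpoly.independent_span_bound[OF fin(1) C(3)] C(2) fin(2) by blast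
  define B where "B = C - A"
  have finB: "finite B" and finA: "finite A" and AB: "A \<inter> B = {}" "A \<union> B = C"
    using finC C(1) by (auto simp: B_def intro: finite_subset)
  have spA: "mpoly.span A = W" using A W by (simp add: mpoly.span_subspace)
  have zero: "c b = 0" if w: "(\<Sum>b\<in>B. mpoly_scale (c b) b) \<in> W" and b: "b \<in> B" for c b
  proof -
    obtain u where u: "(\<Sum>b\<in>B. mpoly_scale (c b) b) = (\<Sum>a\<in>A. mpoly_scale (u a) a)"
      using w unfolding spA[symmetric] mpoly.span_finite[OF finA] by blast
    define g where "g x = (if x \<in> B then c x else - u x)" for x
    have "(\<Sum>x\<in>C. mpoly_scale (g x) x)
        = (\<Sum>x\<in>A. mpoly_scale (g x) x) + (\<Sum>x\<in>B. mpoly_scale (g x) x)"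
      unfolding AB(2)[symmetric] by (rule sum.union_disjoint[OF finA finB AB(1)])
    also have "(\<Sum>x\<in>A. mpoly_scale (g x) x) = - (\<Sum>x\<in>A. mpoly_scale (u x) x)"
      unfolding sum_negf[symmetric] using AB
      by (intro sum.cong) (auto simp: g_def mpoly.scale_minus_left)
    also have "(\<Sum>x\<in>B. mpoly_scale (g x) x) = (\<Sum>x\<in>B. mpoly_scale (c x) x)"
      by (intro sum.cong) (auto simp: g_def)
    finally have "(\<Sum>x\<in>C. mpoly_scale (g x) x) = 0" using u by simp
    then have "g b = 0"
      using mpoly.independentD[OF C(3) finC] b B_def by blast
    then show ?thesis using b by (simp add: g_def)
  qed
  have "\<exists>!c. c \<in> B \<rightarrow>\<^sub>E UNIV \<and> v - (\<Sum>b\<in>B. mpoly_scale (c b) b) \<in> W" if "v \<in> V" for v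
  proof -
    obtain u where u: "v = (\<Sum>x\<in>C. mpoly_scale (u x) x)"
      using \<open>v \<in> V\<close> C(4) unfolding mpoly.span_finite[OF finC] by blast
    have "v = (\<Sum>x\<in>A. mpoly_scale (u x) x) + (\<Sum>x\<in>B. mpoly_scale (u x) x)"
      unfolding u AB(2)[symmetric] by (rule sum.union_disjoint[OF finA finB AB(1)])
    moreover have "(\<Sum>x\<in>A. mpoly_scale (u x) x) \<in> W"
      using A W by (intro mpoly.subspace_sum mpoly.subspace_scale) auto
    ultimately have ex: "v - (\<Sum>b\<in>B. mpoly_scale (restrict u B b) b) \<in> W"
      by (simp cong: sum.cong)
    show ?thesis
    proof (rule ex1I[of _ "restrict u B"])
      show "restrict u B \<in> B \<rightarrow>\<^sub>E UNIV \<and> v - (\<Sum>b\<in>B. mpoly_scale (restrict u B b) b) \<in> W"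
        using ex by auto
      fix c assume c: "c \<in> B \<rightarrow>\<^sub>E UNIV \<and> v - (\<Sum>b\<in>B. mpoly_scale (c b) b) \<in> W"
      then have "(v - (\<Sum>b\<in>B. mpoly_scale (restrict u B b) b))
          - (v - (\<Sum>b\<in>B. mpoly_scale (c b) b)) \<in> W"
        using ex W mpoly.subspace_diff by blast
      then have "(\<Sum>b\<in>B. mpoly_scale (c b - restrict u B b) b) \<in> W"
        by (simp add: mpoly.scale_left_diff_distrib sum_subtractf algebra_simps)
      then have "c b - restrict u B b = 0" if "b \<in> B" for b
        using zero[of "\<lambda>b. c b - restrict u B b"] that by blast
      then show "c = restrict u B"
        using c by (intro PiE_ext[of _ B "\<lambda>_. UNIV"]) auto
    qed
  qed
  then have "quotient_basis V W B"
    using finB C(2) unfolding quotient_basis_def B_def by blast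
  then show thesis by (rule that)
qed

lemma quotient_dim_eq:
  fixes V W :: "'v mpoly set"
  assumes "mpoly.subspace W" "mpoly.subspace V" "W \<subseteq> V" "finite T" "V \<subseteq> mpoly.span T"
  shows "quotient_dim V W = mpoly.dim V - mpoly.dim W"
proof -
  obtain B where B: "quotient_basis V W B"
    using quotient_basis_exists[OF assms] .
  have card: "card B' = mpoly.dim V - mpoly.dim W" if "quotient_basis V W B'" for B'
    using quotient_basis_card[OF assms that] by simp
  show ?thesis
    unfolding quotient_dim_def
  proof (rule the_equality)
    show "\<exists>B. quotient_basis V W B \<and> card B = mpoly.dim V - mpoly.dim W"
      using B card by blast
  qed (use card in blast)
qed

end

(*
  Upper bound: if f is a sum of r squares of forms p_i and r(r+1)/2 exceeds the dimension of
  the space of forms of degree 2d, then the products p_i p_j satisfy a nontrivial symmetric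
  linear relation S.  Subtracting a multiple of S from the identity Gram matrix makes it positive
  semidefinite and singular, so r - 1 squares suffice.

  Lower bound: let Z consist of s = N_d - m general points and let p_1, ..., p_m be a basis of the
  forms of degree d vanishing on Z.  As s >= N_{d-1}, no form of smaller degree vanishes on Z, so
  the square of the ideal I(Z) is spanned in degree 2d by the products p_i p_j.  If
  C(m+1, 2) <= N_{2d} - ns, the conjecture gives it dimension C(m+1, 2), so these products are
  linearly independent.  Squares in any representation of f = p_1^2 + ... + p_m^2 must vanish on Z
  as well, hence the identity is the only Gram matrix of f and f has length m.
*)
theory Submission
  imports Defs "HOL-Analysis.Function_Topology" "HOL-Computational_Algebra.Polynomial"
    "HOL-Real_Asymp.Real_Asymp"
begin

section \<open>Linear algebra\<close>

text \<open>Both constants come from triangular numbers. Every length r obeys r(r+1)/2 <= N_{2d},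
  and N_{2d} grows like (2d)^(n-1)/(n-1)!, which yields C_n. From below, m(m+1)/2 may grow up to
  N_{2d} - n N_d, whose leading coefficient is (2^(n-1) - n)/(n-1)!; doubling and taking the root
  yields c_n. The condition s >= N_{d-1} also limits m to N_{n-1,d}, of order d^(n-2). This is of
  larger order than d^((n-1)/2) exactly when n > 3, whence n >= 4.

  The conjecture speaks of some nonempty open set of tuples, while the points must in addition
  impose independent conditions on the forms of degrees d and d - 1. Such a tuple is built inside
  the open set. The construction gives only upper bounds for the spaces of vanishing forms; that a
  basis has exactly m elements follows afterwards, because the dimension known from the conjecture
  cannot exceed the number of products.\<close>

text \<open>With a nontrivial relation one generator would be redundant, and \<open>W\<close> would
  lie in the span of fewer than \<open>card I\<close> elements. Coefficients are indexed by
  \<open>I\<close>, so a coincidence \<open>g i = g j\<close> counts as a relation too.\<close>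

lemma trivial_relations_if_card_le_dim:
  fixes g :: "'i \<Rightarrow> 'v mpoly"
  assumes I: "finite I" and W: "W \<subseteq> mpoly.span (g ` I)" and card: "card I \<le> mpoly.dim W"
    and rel: "(\<Sum>i\<in>I. mpoly_scale (c i) (g i)) = 0" and k: "k \<in> I"
  shows "c k = 0"
proof (rule ccontr)
  assume ck: "c k \<noteq> 0"
  have "mpoly_scale (c k) (g k) + (\<Sum>i\<in>I - {k}. mpoly_scale (c i) (g i)) = 0"
    using rel sum.remove[OF I k, of "\<lambda>i. mpoly_scale (c i) (g i)"] by simp
  then have "mpoly_scale (c k) (g k) = - (\<Sum>i\<in>I - {k}. mpoly_scale (c i) (g i))"
    by (simp only: add_eq_0_iff2)
  then have "mpoly_scale (c k) (g k) \<in> mpoly.span (g ` (I - {k}))"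
    by (auto intro!: mpoly.span_neg mpoly.span_sum mpoly.span_scale intro: mpoly.span_base)
  then have "mpoly_scale (1 / c k) (mpoly_scale (c k) (g k)) \<in> mpoly.span (g ` (I - {k}))"
    by (rule mpoly.span_scale)
  then have "g k \<in> mpoly.span (g ` (I - {k}))" using ck by simp
  then have "g ` I \<subseteq> mpoly.span (g ` (I - {k}))"
    by (auto intro: mpoly.span_base)
  then have "W \<subseteq> mpoly.span (g ` (I - {k}))"
    using W mpoly.span_minimal[OF _ mpoly.subspace_span] by blast
  then have "mpoly.dim W \<le> card (g ` (I - {k}))"
    using I by (intro mpoly.dim_le_card) auto
  also have "\<dots> \<le> card (I - {k})" using I by (intro card_image_le) auto
  also have "\<dots> < card I" using I k by (intro psubset_card_mono) auto
  finally show False using card by simp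
qed

lemma card_le_dim_of_independent:
  fixes V :: "'v mpoly set"
  assumes A: "mpoly.independent A" "A \<subseteq> V" and T: "finite T" "V \<subseteq> mpoly.span T"
  shows "finite A \<and> card A \<le> mpoly.dim V"
proof -
  obtain B where B: "B \<subseteq> V" "mpoly.independent B" "V \<subseteq> mpoly.span B" "card B = mpoly.dim V"
    by (rule mpoly.basis_exists)
  have "finite B"
    using mpoly.independent_span_bound[OF T(1) B(2)] B(1) T(2) by blast
  then show ?thesis
    using mpoly.independent_span_bound[OF _ A(1), of B] A(2) B by auto
qed

text \<open>Either the members are distinct and dependent as a set, or a repeated member gives a
  relation with coefficients 1 and -1.\<close>

lemma nontrivial_relation_if_card_gt_dim:
  fixes g :: "'i \<Rightarrow> 'v mpoly"
  assumes I: "finite I" and V: "g ` I \<subseteq> V" and T: "finite T" "V \<subseteq> mpoly.span T"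
    and card: "mpoly.dim V < card I"
  obtains c k where "k \<in> I" "c k \<noteq> 0" "(\<Sum>i\<in>I. mpoly_scale (c i) (g i)) = 0"
proof (cases "inj_on g I")
  case True
  then have "card (g ` I) = card I" by (rule card_image)
  then have "mpoly.dependent (g ` I)"
    using card_le_dim_of_independent[OF _ V T] card by auto
  then obtain u v where "(\<Sum>x\<in>g ` I. mpoly_scale (u x) x) = 0" "v \<in> g ` I" "u v \<noteq> 0"
    using mpoly.dependent_finite[of "g ` I"] I by blast
  then show ?thesis
    using that[of _ "u \<circ> g"] True by (auto simp: sum.reindex)
next
  case False
  then obtain i j where ij: "i \<in> I" "j \<in> I" "i \<noteq> j" "g i = g j" by (auto simp: inj_on_def)
  define c :: "'i \<Rightarrow> real" where "c x = (if x = i then 1 else if x = j then -1 else 0)" for x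
  have "(\<Sum>x\<in>I. mpoly_scale (c x) (g x)) = (\<Sum>x\<in>{i, j}. mpoly_scale (c x) (g x))"
    using I ij by (intro sum.mono_neutral_right) (auto simp: c_def)
  also have "\<dots> = 0" using ij by (simp add: c_def)
  finally show ?thesis using that[of i c] ij by (simp add: c_def)
qed

lemma dim_less_of_psubspace:
  fixes V W :: "'v mpoly set"
  assumes W: "mpoly.subspace W" "W \<subseteq> V" and g: "g \<in> V" "g \<notin> W"
    and T: "finite T" "V \<subseteq> mpoly.span T"
  shows "mpoly.dim W < mpoly.dim V"
proof -
  obtain A where A: "A \<subseteq> W" "mpoly.independent A" "W \<subseteq> mpoly.span A" "card A = mpoly.dim W"
    by (rule mpoly.basis_exists)
  have "mpoly.span A = W" using A W by (simp add: mpoly.span_subspace)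
  then have "mpoly.independent (insert g A)" using A g by (intro mpoly.independent_insertI) auto
  moreover have "insert g A \<subseteq> V" using A W g by auto
  ultimately have "finite (insert g A) \<and> card (insert g A) \<le> mpoly.dim V"
    by (intro card_le_dim_of_independent[OF _ _ T])
  moreover have "g \<notin> A" using A g by auto
  ultimately show ?thesis using A by auto
qed

section \<open>Evaluation\<close>

lemma mpoly_eval_superset:
  assumes "finite A" "Poly_Mapping.keys p \<subseteq> A"
  shows "mpoly_eval x p = (\<Sum>m\<in>A. Poly_Mapping.lookup p m *
        (\<Prod>v\<in>Poly_Mapping.keys m. x v ^ Poly_Mapping.lookup m v))"
  unfolding mpoly_eval_def using assms
  by (intro sum.mono_neutral_left) (auto simp: in_keys_iff)

lemma mpoly_eval_zero [simp]: "mpoly_eval x 0 = 0"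
  by (simp add: mpoly_eval_def)

lemma mpoly_eval_add: "mpoly_eval x (p + q) = mpoly_eval x p + mpoly_eval x q"
proof -
  let ?A = "Poly_Mapping.keys p \<union> Poly_Mapping.keys q"
  have "Poly_Mapping.keys (p + q) \<subseteq> ?A" by (rule Poly_Mapping.keys_add)
  then show ?thesis
    by (simp add: mpoly_eval_superset[of ?A] lookup_add algebra_simps sum.distrib)
qed

lemma mpoly_eval_sum: "mpoly_eval x (\<Sum>i\<in>I. p i) = (\<Sum>i\<in>I. mpoly_eval x (p i))"
  by (induction I rule: infinite_finite_induct) (auto simp: mpoly_eval_add)

lemma mpoly_eval_single:
  "mpoly_eval x (Poly_Mapping.single m c) =
     c * (\<Prod>v\<in>Poly_Mapping.keys m. x v ^ Poly_Mapping.lookup m v)"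
  by (simp add: mpoly_eval_superset[of "{m}"])

lemma prod_keys_superset:
  assumes "finite A" "Poly_Mapping.keys m \<subseteq> A"
  shows "(\<Prod>v\<in>Poly_Mapping.keys m. x v ^ Poly_Mapping.lookup m v)
       = (\<Prod>v\<in>A. (x v :: real) ^ Poly_Mapping.lookup m v)"
  using assms by (intro prod.mono_neutral_left) (auto simp: in_keys_iff)

lemma mpoly_eval_mult_single:
  "mpoly_eval x (Poly_Mapping.single m c * Poly_Mapping.single m' c') =
     mpoly_eval x (Poly_Mapping.single m c) * mpoly_eval x (Poly_Mapping.single m' c')"
proof -
  let ?A = "Poly_Mapping.keys m \<union> Poly_Mapping.keys m'"
  have sub: "Poly_Mapping.keys (m + m') \<subseteq> ?A" by (rule Poly_Mapping.keys_add)
  show ?thesis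
    unfolding mult_single mpoly_eval_single
    by (subst (1 2 3) prod_keys_superset[of ?A])
       (use sub in \<open>auto simp: lookup_add power_add prod.distrib\<close>)
qed

lemma mpoly_sum_single:
  "p = (\<Sum>m\<in>Poly_Mapping.keys p. Poly_Mapping.single m (Poly_Mapping.lookup p m))"
  by (rule poly_mapping_eqI)
     (auto simp: lookup_sum lookup_single when_def in_keys_iff if_distrib cong: if_cong)

lemma mpoly_eval_mult: "mpoly_eval x (p * q) = mpoly_eval x p * mpoly_eval x q"
proof -
  let ?P = "\<lambda>p m. Poly_Mapping.single m (Poly_Mapping.lookup p m)"
  have "p * q = (\<Sum>m\<in>Poly_Mapping.keys p. \<Sum>m'\<in>Poly_Mapping.keys q. ?P p m * ?P q m')"
    by (subst mpoly_sum_single[of p], subst mpoly_sum_single[of q]) (rule sum_product)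
  then have "mpoly_eval x (p * q)
      = (\<Sum>m\<in>Poly_Mapping.keys p. mpoly_eval x (?P p m)) * (\<Sum>m\<in>Poly_Mapping.keys q. mpoly_eval x (?P q m))"
    by (simp add: mpoly_eval_sum mpoly_eval_mult_single sum_product)
  then show ?thesis
    by (simp flip: mpoly_eval_sum mpoly_sum_single)
qed

lemma mpoly_eval_scale [simp]: "mpoly_eval x (mpoly_scale c p) = c * mpoly_eval x p"
  by (simp add: mpoly_scale_def mpoly_eval_mult mpoly_eval_single)

text \<open>Each variable is replaced by the linear polynomial \<open>[:a v, b v:]\<close>.
  Questions of non-vanishing thereby reduce to one-variable polynomials.\<close>

lemma mpoly_eval_on_line:
  "\<exists>P. \<forall>t. mpoly_eval (\<lambda>v. a v + t * b v) p = poly P t"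
  by (intro exI[of _ "\<Sum>m\<in>Poly_Mapping.keys p. smult (Poly_Mapping.lookup p m)
        (\<Prod>v\<in>Poly_Mapping.keys m. [:a v, b v:] ^ Poly_Mapping.lookup m v)"])
     (simp add: mpoly_eval_def poly_sum poly_prod)

section \<open>Forms\<close>

lemma forms_iff:
  "p \<in> forms n e \<longleftrightarrow> (\<forall>m\<in>Poly_Mapping.keys p. Poly_Mapping.keys m \<subseteq> {..<n} \<and>
      (\<Sum>i<n. Poly_Mapping.lookup m i) = e)"
  by (auto simp: forms_def mpoly_ring_def)

lemma forms_mult:
  assumes "p \<in> forms n d" "q \<in> forms n e"
  shows "p * q \<in> forms n (d + e)"
  unfolding forms_iff
proof
  fix m assume "m \<in> Poly_Mapping.keys (p * q)"
  then obtain a b where ab: "a \<in> Poly_Mapping.keys p" "b \<in> Poly_Mapping.keys q" "m = a + b"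
    using keys_mult[of p q] by auto
  have "Poly_Mapping.keys a \<subseteq> {..<n}" "Poly_Mapping.keys b \<subseteq> {..<n}"
    using assms ab by (auto simp: forms_iff)
  then have "Poly_Mapping.keys m \<subseteq> {..<n}"
    using ab(3) Poly_Mapping.keys_add[of a b] by blast
  then show "Poly_Mapping.keys m \<subseteq> {..<n} \<and> (\<Sum>i<n. Poly_Mapping.lookup m i) = d + e"
    using assms ab by (simp add: forms_iff lookup_add sum.distrib)
qed

lemma keys_mpoly_scale: "Poly_Mapping.keys (mpoly_scale c p) \<subseteq> Poly_Mapping.keys p"
  using keys_mult[of "Poly_Mapping.single 0 c" p] by (auto simp: mpoly_scale_def split: if_splits)

lemma subspace_forms: "mpoly.subspace (forms n e)"
proof (rule mpoly.subspaceI)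
  show "x + y \<in> forms n e" if "x \<in> forms n e" "y \<in> forms n e" for x y
    using that Poly_Mapping.keys_add[of x y] by (fastforce simp: forms_iff)
  show "mpoly_scale c x \<in> forms n e" if "x \<in> forms n e" for c x
    using that keys_mpoly_scale[of c x] by (fastforce simp: forms_iff)
qed (simp add: forms_iff)

definition monomials :: "nat \<Rightarrow> nat \<Rightarrow> (nat \<Rightarrow>\<^sub>0 nat) set" where
  "monomials n e = {m. Poly_Mapping.keys m \<subseteq> {..<n} \<and> (\<Sum>i<n. Poly_Mapping.lookup m i) = e}"

text \<open>Stars and bars: exponent vectors correspond to lists of length \<open>n\<close> with sum
  \<open>e\<close>. The list count is a binomial coefficient with lower index \<open>e\<close>,
  turned into lower index \<open>n - 1\<close> by symmetry.\<close>

lemma finite_card_monomials: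
  assumes "1 \<le> n"
  shows "finite (monomials n e) \<and> card (monomials n e) = num_forms n e"
proof -
  define L where "L = {l::nat list. length l = n \<and> sum_list l = e}"
  have "bij_betw (\<lambda>m. map (Poly_Mapping.lookup m) [0..<n]) (monomials n e) L"
  proof (rule bij_betw_byWitness[where f' = Poly_Mapping.nth])
    show "\<forall>m\<in>monomials n e. Poly_Mapping.nth (map (Poly_Mapping.lookup m) [0..<n]) = m"
      by (auto intro!: poly_mapping_eqI simp: monomials_def nth_default_def not_in_keys_iff_lookup_eq_zero
          subset_iff in_keys_iff)
    show "\<forall>l\<in>L. map (Poly_Mapping.lookup (Poly_Mapping.nth l)) [0..<n] = l"
      by (auto intro!: nth_equalityI simp: L_def nth_default_def)
    show "(\<lambda>m. map (Poly_Mapping.lookup m) [0..<n]) ` monomials n e \<subseteq> L"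
      by (auto simp: L_def monomials_def sum_list_sum_nth atLeast0LessThan)
    show "Poly_Mapping.nth ` L \<subseteq> monomials n e"
      by (auto simp: L_def monomials_def sum_list_sum_nth atLeast0LessThan in_keys_iff nth_default_def
          split: if_splits simp del: keys_nth)
  qed
  moreover have "finite L"
    by (rule finite_subset[OF _ finite_lists_length_eq[of "{..e}" n]])
       (auto simp: L_def dest: member_le_sum_list)
  moreover have "card L = num_forms n e"
    using assms binomial_symmetric[of e "n + e - 1"]
    by (simp add: L_def card_length_sum_list num_forms_def add.commute)
  ultimately show ?thesis
    by (simp add: bij_betw_finite bij_betw_same_card)
qed

lemma mpoly_scale_single [simp]:
  "mpoly_scale c (Poly_Mapping.single m a) = Poly_Mapping.single m (c * a)"
  by (simp add: mpoly_scale_def mult_single)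

lemma forms_eq_span: "forms n e = mpoly.span ((\<lambda>m. Poly_Mapping.single m 1) ` monomials n e)"
proof
  show "forms n e \<subseteq> mpoly.span ((\<lambda>m. Poly_Mapping.single m 1) ` monomials n e)"
  proof
    fix p assume p: "p \<in> forms n e"
    have "(\<Sum>m\<in>Poly_Mapping.keys p. mpoly_scale (Poly_Mapping.lookup p m) (Poly_Mapping.single m 1))
        \<in> mpoly.span ((\<lambda>m. Poly_Mapping.single m 1) ` monomials n e)"
      using p by (intro mpoly.span_sum mpoly.span_scale mpoly.span_base)
        (auto simp: forms_iff monomials_def)
    then show "p \<in> mpoly.span ((\<lambda>m. Poly_Mapping.single m 1) ` monomials n e)"
      by (simp flip: mpoly_sum_single)
  qed
  show "mpoly.span ((\<lambda>m. Poly_Mapping.single m 1) ` monomials n e) \<subseteq> forms n e"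
    by (rule mpoly.span_minimal[OF _ subspace_forms]) (auto simp: forms_iff monomials_def)
qed

lemma forms_finite_span:
  assumes "1 \<le> n"
  obtains T where "finite T" "forms n e \<subseteq> mpoly.span T"
  using finite_card_monomials[OF assms, of e] forms_eq_span[of n e] by blast

lemma dim_forms:
  assumes "1 \<le> n"
  shows "mpoly.dim (forms n e) = num_forms n e"
proof -
  define S :: "nat mpoly set" where "S = (\<lambda>m. Poly_Mapping.single m 1) ` monomials n e"
  have fin: "finite (monomials n e)" and card: "card (monomials n e) = num_forms n e"
    using finite_card_monomials[OF assms] by auto
  have inj: "inj_on (\<lambda>m. Poly_Mapping.single m (1::real)) A" for A :: "(nat \<Rightarrow>\<^sub>0 nat) set"
    by (rule inj_onI) (metis keys_single one_neq_zero the_elem_eq)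
  have "mpoly.independent S"
  proof (rule mpoly.independent_if_scalars_zero)
    fix f x assume 0: "(\<Sum>x\<in>S. mpoly_scale (f x) x) = 0" and "x \<in> S"
    then obtain m where m: "m \<in> monomials n e" "x = Poly_Mapping.single m 1" by (auto simp: S_def)
    have "0 = Poly_Mapping.lookup (\<Sum>x\<in>S. mpoly_scale (f x) x) m" using 0 by simp
    also have "\<dots> = (\<Sum>k\<in>monomials n e. if k = m then f (Poly_Mapping.single m 1) else 0)"
      unfolding S_def sum.reindex[OF inj] lookup_sum
      by (intro sum.cong) (auto simp: lookup_single when_def)
    also have "\<dots> = f x" using m fin by simp
    finally show "f x = 0" by simp
  qed (use fin S_def in auto)
  then have "mpoly.dim (forms n e) = card S"
    unfolding forms_eq_span S_def[symmetric] by (rule mpoly.dim_span_eq_card_independent)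
  then show ?thesis by (simp add: S_def card_image[OF inj] card)
qed

section \<open>Points where given polynomials do not vanish\<close>

text \<open>Reduction modulo \<open>B\<close> isolates the lowest digit. This uniqueness makes the
  Kronecker substitution below injective on monomials.\<close>

lemma digits_unique:
  fixes f g :: "nat \<Rightarrow> nat"
  assumes "\<And>i. i < n \<Longrightarrow> f i < B" "\<And>i. i < n \<Longrightarrow> g i < B"
    and "(\<Sum>i<n. f i * B ^ i) = (\<Sum>i<n. g i * B ^ i)" "i < n"
  shows "f i = g i"
  using assms
proof (induction n arbitrary: f g i)
  case (Suc n)
  have split: "(\<Sum>i<Suc n. h i * B ^ i) = h 0 + B * (\<Sum>i<n. h (Suc i) * B ^ i)" for h :: "nat \<Rightarrow> nat"
    unfolding sum.lessThan_Suc_shift by (simp add: sum_distrib_left algebra_simps)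
  have eq: "f 0 + B * (\<Sum>i<n. f (Suc i) * B ^ i) = g 0 + B * (\<Sum>i<n. g (Suc i) * B ^ i)"
    using Suc.prems(3) by (simp only: split)
  have lt: "f 0 < B" "g 0 < B" using Suc.prems(1,2)[of 0] by auto
  have 0: "f 0 = g 0" using arg_cong[OF eq, of "\<lambda>x. x mod B"] lt by simp
  then have "(\<Sum>i<n. f (Suc i) * B ^ i) = (\<Sum>i<n. g (Suc i) * B ^ i)" using eq lt by simp
  then have "f (Suc j) = g (Suc j)" if "j < n" for j
    using Suc.IH[of "\<lambda>i. f (Suc i)" "\<lambda>i. g (Suc i)" j] Suc.prems(1,2) that by auto
  then show ?case using 0 Suc.prems(4) by (cases i) auto
qed simp

lemma nonzero_form_nonvanishing:
  assumes p: "p \<in> forms n e" "p \<noteq> 0"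
  obtains x where "\<forall>i\<ge>n. x i = 0" "mpoly_eval x p \<noteq> 0"
proof -
  \<comment> \<open>Kronecker substitution: distinct monomials of degree \<open>e\<close> become distinct powers of \<open>t\<close>.\<close>
  define code :: "(nat \<Rightarrow>\<^sub>0 nat) \<Rightarrow> nat" where
    "code m = (\<Sum>i<n. Poly_Mapping.lookup m i * Suc e ^ i)" for m
  define x :: "real \<Rightarrow> nat \<Rightarrow> real" where "x t i = (if i < n then t ^ (Suc e ^ i) else 0)" for t i
  define Q where "Q = (\<Sum>m\<in>Poly_Mapping.keys p. Polynomial.monom (Poly_Mapping.lookup p m) (code m))"
  have mono: "Poly_Mapping.keys m \<subseteq> {..<n}" "(\<Sum>i<n. Poly_Mapping.lookup m i) = e"
    if "m \<in> Poly_Mapping.keys p" for m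
    using that p by (auto simp: forms_iff)
  have le: "Poly_Mapping.lookup m i < Suc e" if "m \<in> Poly_Mapping.keys p" "i < n" for m i
    using member_le_sum[of i "{..<n}" "Poly_Mapping.lookup m"] mono(2)[OF that(1)] that(2) by simp
  have inj: "inj_on code (Poly_Mapping.keys p)"
  proof (rule inj_onI)
    fix m m' assume m: "m \<in> Poly_Mapping.keys p" "m' \<in> Poly_Mapping.keys p" "code m = code m'"
    show "m = m'"
    proof (rule poly_mapping_eqI)
      fix i
      show "Poly_Mapping.lookup m i = Poly_Mapping.lookup m' i"
      proof (cases "i < n")
        case True
        then show ?thesis
          using digits_unique[of n "Poly_Mapping.lookup m" "Suc e" "Poly_Mapping.lookup m'" i] m le
          by (simp add: code_def)
      next
        case False
        then have "i \<notin> Poly_Mapping.keys m" "i \<notin> Poly_Mapping.keys m'" using mono(1) m by auto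
        then show ?thesis by (simp add: in_keys_iff)
      qed
    qed
  qed
  have eval: "mpoly_eval (x t) p = poly Q t" for t
  proof -
    have "(\<Prod>v\<in>Poly_Mapping.keys m. x t v ^ Poly_Mapping.lookup m v) = t ^ code m"
      if "m \<in> Poly_Mapping.keys p" for m
      using mono(1)[OF that]
      by (subst prod_keys_superset[of "{..<n}"])
         (simp_all add: x_def code_def power_sum mult.commute flip: power_mult)
    then show ?thesis
      by (simp add: mpoly_eval_def Q_def poly_sum poly_monom)
  qed
  obtain m0 where m0: "m0 \<in> Poly_Mapping.keys p" using p(2) by (metis all_not_in_conv keys_eq_empty)
  have "Polynomial.coeff Q (code m0)
      = (\<Sum>m\<in>Poly_Mapping.keys p. if m = m0 then Poly_Mapping.lookup p m0 else 0)"
    unfolding Q_def coeff_sum using inj m0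
    by (intro sum.cong) (auto simp: coeff_monom dest: inj_onD)
  also have "\<dots> \<noteq> 0" using m0 by (simp add: in_keys_iff)
  finally have "Q \<noteq> 0" by auto
  then obtain t where "poly Q t \<noteq> 0" using poly_all_0_iff_0 by blast
  then show thesis using that[of "x t"] eval by (simp add: x_def)
qed

lemma common_nonvanishing_on_line:
  fixes P Q :: "real poly"
  assumes "poly P a \<noteq> 0" "poly Q b \<noteq> 0"
  obtains t where "poly P t \<noteq> 0" "poly Q t \<noteq> 0"
proof -
  have "P * Q \<noteq> 0" using assms by auto
  then obtain t where "poly (P * Q) t \<noteq> 0" using poly_all_0_iff_0 by blast
  then show thesis using that by auto
qed

text \<open>The one property of polynomial functions on which the choice of points rests. It covers
  a form evaluated at a point as well as a multiform in which a single point varies and the others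
  are fixed.\<close>

definition polynomial_on_lines :: "((nat \<Rightarrow> real) \<Rightarrow> real) \<Rightarrow> bool" where
  "polynomial_on_lines h \<longleftrightarrow> (\<forall>a b. \<exists>P. \<forall>t. h (\<lambda>j. a j + t * b j) = poly P t)"

lemma polynomial_on_lines_mpoly_eval: "polynomial_on_lines (\<lambda>x. mpoly_eval x p)"
  unfolding polynomial_on_lines_def using mpoly_eval_on_line by blast

lemma polynomial_on_lines_mult:
  assumes "polynomial_on_lines g" "polynomial_on_lines h"
  shows "polynomial_on_lines (\<lambda>x. g x * h x)"
  unfolding polynomial_on_lines_def
proof (intro allI)
  fix a b
  obtain P Q where "\<forall>t. g (\<lambda>j. a j + t * b j) = poly P t" "\<forall>t. h (\<lambda>j. a j + t * b j) = poly Q t"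
    using assms unfolding polynomial_on_lines_def by meson
  then show "\<exists>P. \<forall>t. g (\<lambda>j. a j + t * b j) * h (\<lambda>j. a j + t * b j) = poly P t"
    by (intro exI[of _ "P * Q"]) simp
qed

text \<open>On the line joining the two witnesses, \<open>g\<close> is nonzero at parameter 0 and
  \<open>h\<close> at parameter 1, so both restrict to nonzero polynomials and their product has a
  non-root. The line stays inside the vectors supported on the first \<open>n\<close>
  coordinates.\<close>

lemma common_nonvanishing:
  assumes "polynomial_on_lines g" "polynomial_on_lines h"
    and "g a \<noteq> 0" "h b \<noteq> 0" "\<forall>j\<ge>n. a j = 0" "\<forall>j\<ge>n. b j = 0"
  obtains x where "g x \<noteq> 0" "h x \<noteq> 0" "\<forall>j\<ge>n. x j = 0"
proof -
  obtain P Q where P: "\<forall>t. g (\<lambda>j. a j + t * (b j - a j)) = poly P t"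
    and Q: "\<forall>t. h (\<lambda>j. a j + t * (b j - a j)) = poly Q t"
    using assms(1,2) unfolding polynomial_on_lines_def by meson
  have "poly P 0 \<noteq> 0" "poly Q 1 \<noteq> 0"
    using P[rule_format, of 0] Q[rule_format, of 1] assms(3,4) by auto
  then obtain t where "poly P t \<noteq> 0" "poly Q t \<noteq> 0" by (rule common_nonvanishing_on_line)
  then show thesis using that[of "\<lambda>j. a j + t * (b j - a j)"] P Q assms(5,6) by auto
qed

section \<open>Points imposing independent conditions\<close>

text \<open>The set \<open>X\<close> consists of coordinate vectors, in the application one
  representative per point, whereas \<open>vanishing_ideal\<close> tests all
  representatives.\<close>

definition vanishing_forms :: "nat \<Rightarrow> nat \<Rightarrow> (nat \<Rightarrow> real) set \<Rightarrow> nat mpoly set" where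
  "vanishing_forms n e X = {f \<in> forms n e. \<forall>x\<in>X. mpoly_eval x f = 0}"

lemma subspace_vanishing_forms: "mpoly.subspace (vanishing_forms n e X)"
  using subspace_forms[of n e]
  by (auto simp: vanishing_forms_def mpoly.subspace_def mpoly_eval_add)

lemma monomial_form:
  assumes "1 \<le> n"
  shows "Poly_Mapping.single (Poly_Mapping.single 0 e) 1 \<in> forms n e"
  using assms by (auto simp: forms_iff lookup_single when_def)

text \<open>Any nonzero form that vanishes on \<open>X\<close> serves as \<open>g\<close>: a point
  with \<open>g\<close> nonzero there removes \<open>g\<close> from the space. If there is no such
  form, the dimension is already 0 and a power of the first variable serves as \<open>g\<close>. The
  vector \<open>b\<close> records that \<open>g\<close> is nonzero somewhere.\<close>

lemma generic_point_drops_dim: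
  assumes "1 \<le> n"
  obtains g b where "g \<in> forms n e" "\<forall>i\<ge>n. b i = 0" "mpoly_eval b g \<noteq> 0"
    and "\<forall>t. mpoly_eval t g \<noteq> 0 \<longrightarrow>
      mpoly.dim (vanishing_forms n e (insert t X)) \<le> mpoly.dim (vanishing_forms n e X) - 1"
proof -
  obtain T where T: "finite T" "forms n e \<subseteq> mpoly.span T"
    using forms_finite_span[OF assms] .
  have VT: "vanishing_forms n e X \<subseteq> mpoly.span T" for X
    using T by (auto simp: vanishing_forms_def)
  show thesis
  proof (cases "vanishing_forms n e X \<subseteq> {0}")
    case True
    let ?g = "Poly_Mapping.single (Poly_Mapping.single 0 e) 1 :: nat mpoly"
    have g: "?g \<in> forms n e" "?g \<noteq> 0"
      using monomial_form[OF assms] by (auto simp flip: keys_eq_empty)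
    obtain b where b: "\<forall>i\<ge>n. b i = 0" "mpoly_eval b ?g \<noteq> 0"
      using nonzero_form_nonvanishing[OF g] .
    have "mpoly.dim (vanishing_forms n e (insert t X)) \<le> card ({} :: nat mpoly set)" for t
      using True by (intro mpoly.dim_le_card) (auto simp: vanishing_forms_def)
    then show thesis using that[OF g(1) b] by simp
  next
    case False
    then obtain g where g: "g \<in> vanishing_forms n e X" "g \<noteq> 0" by auto
    then have gf: "g \<in> forms n e" by (simp add: vanishing_forms_def)
    obtain b where b: "\<forall>i\<ge>n. b i = 0" "mpoly_eval b g \<noteq> 0"
      using nonzero_form_nonvanishing[OF gf g(2)] .
    have "mpoly.dim (vanishing_forms n e (insert t X)) < mpoly.dim (vanishing_forms n e X)"
      if "mpoly_eval t g \<noteq> 0" for t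
      by (rule dim_less_of_psubspace[OF subspace_vanishing_forms _ g(1) _ T(1) VT])
         (use that in \<open>auto simp: vanishing_forms_def\<close>)
    then show thesis using that[OF gf b] by fastforce
  qed
qed

text \<open>
  The points of a given tuple \<open>y\<close> with \<open>F y \<noteq> 0\<close> are replaced one at a time. Each new point only has to avoid
  the zero sets of finitely many nonzero polynomials, and on a line these are finite, so no
  irreducibility of the space of tuples is needed.
\<close>

lemma generic_points_exist:
  fixes F :: "(nat \<times> nat) mpoly"
  assumes n: "1 \<le> n" and d: "1 \<le> d"
    and y: "\<forall>i. \<forall>j\<ge>n. y i j = 0" "mpoly_eval (\<lambda>(i, j). y i j) F \<noteq> 0"
  shows "\<exists>x. (\<forall>i. \<forall>j\<ge>n. x i j = 0) \<and> mpoly_eval (\<lambda>(i, j). x i j) F \<noteq> 0 \<and>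
    (\<forall>i<k. x i \<noteq> (\<lambda>_. 0)) \<and>
    mpoly.dim (vanishing_forms n d (x ` {..<k})) \<le> num_forms n d - k \<and>
    mpoly.dim (vanishing_forms n (d - 1) (x ` {..<k})) \<le> num_forms n (d - 1) - k"
proof (induction k)
  case 0
  show ?case using y dim_forms[OF n] by (intro exI[of _ y]) (simp add: vanishing_forms_def)
next
  case (Suc k)
  then obtain x where x: "\<forall>i. \<forall>j\<ge>n. x i j = 0" "mpoly_eval (\<lambda>(i, j). x i j) F \<noteq> 0"
    "\<forall>i<k. x i \<noteq> (\<lambda>_. 0)"
    "mpoly.dim (vanishing_forms n d (x ` {..<k})) \<le> num_forms n d - k"
    "mpoly.dim (vanishing_forms n (d - 1) (x ` {..<k})) \<le> num_forms n (d - 1) - k"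
    by blast
  obtain g b where g: "g \<in> forms n d" "\<forall>i\<ge>n. b i = 0" "mpoly_eval b g \<noteq> 0"
    "\<forall>t. mpoly_eval t g \<noteq> 0 \<longrightarrow> mpoly.dim (vanishing_forms n d (insert t (x ` {..<k})))
        \<le> mpoly.dim (vanishing_forms n d (x ` {..<k})) - 1"
    using generic_point_drops_dim[OF n, of d "x ` {..<k}"] .
  \<comment> \<open>Both degrees are handled by the same new point. The truncated difference
    \<open>num_forms n (d - 1) - k\<close> stays 0 once \<open>k\<close> exceeds that number of
    forms.\<close>
  obtain g' b' where g': "g' \<in> forms n (d - 1)" "\<forall>i\<ge>n. b' i = 0" "mpoly_eval b' g' \<noteq> 0"
    "\<forall>t. mpoly_eval t g' \<noteq> 0 \<longrightarrow> mpoly.dim (vanishing_forms n (d - 1) (insert t (x ` {..<k})))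
        \<le> mpoly.dim (vanishing_forms n (d - 1) (x ` {..<k})) - 1"
    using generic_point_drops_dim[OF n, of "d - 1" "x ` {..<k}"] .
  \<comment> \<open>The multiform as a function of the \<open>k\<close>-th point alone; it is
    nonzero at the old \<open>x k\<close>.\<close>
  define h where "h t = mpoly_eval (\<lambda>(i, j). (x(k := t)) i j) F" for t
  have h: "polynomial_on_lines h"
    unfolding polynomial_on_lines_def
  proof (intro allI)
    fix a b :: "nat \<Rightarrow> real"
    let ?a = "\<lambda>(i, j). (x(k := a)) i j" and ?b = "\<lambda>(i, j). if i = k then b j else 0"
    have "(\<lambda>(i, j). (x(k := \<lambda>j. a j + t * b j)) i j) = (\<lambda>v. ?a v + t * ?b v)" for t
      by (auto simp: fun_eq_iff)
    then show "\<exists>P. \<forall>t. h (\<lambda>j. a j + t * b j) = poly P t"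
      using mpoly_eval_on_line[of ?a ?b F] by (simp only: h_def)
  qed
  have hx: "h (x k) \<noteq> 0" using x(2) by (simp add: h_def)
  obtain c where c: "mpoly_eval c g \<noteq> 0" "mpoly_eval c g' \<noteq> 0" "\<forall>j\<ge>n. c j = 0"
    using common_nonvanishing[OF polynomial_on_lines_mpoly_eval polynomial_on_lines_mpoly_eval
        g(3) g'(3) g(2) g'(2)] .
  have cc: "mpoly_eval c g * mpoly_eval c g' \<noteq> 0" using c by simp
  have xk: "\<forall>j\<ge>n. x k j = 0" using x(1) by simp
  obtain t where t: "h t \<noteq> 0" "mpoly_eval t g * mpoly_eval t g' \<noteq> 0" "\<forall>j\<ge>n. t j = 0"
    using common_nonvanishing[OF h polynomial_on_lines_mult[OF polynomial_on_lines_mpoly_eval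
        polynomial_on_lines_mpoly_eval] hx cc xk c(3)] .
  \<comment> \<open>A form of positive degree vanishes at the origin, and \<open>g\<close> does not
    vanish at \<open>t\<close>; this uses \<open>1 \<le> d\<close>.\<close>
  have t0: "t \<noteq> (\<lambda>_. 0)"
  proof
    assume t': "t = (\<lambda>_. 0)"
    have zero: "(\<Prod>v\<in>Poly_Mapping.keys m. t v ^ Poly_Mapping.lookup m v) = 0"
      if "m \<in> Poly_Mapping.keys g" for m
    proof -
      have "m \<noteq> 0" using that g(1) d by (auto simp: forms_iff)
      then have "Poly_Mapping.keys m \<noteq> {}" by (metis poly_mapping_eqI in_keys_iff empty_iff lookup_zero)
      then show ?thesis by (auto simp: t' in_keys_iff power_0_left)
    qed
    have "mpoly_eval t g = 0"
      unfolding mpoly_eval_def by (rule sum.neutral) (use zero in simp)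
    then show False using t(2) by simp
  qed
  have img: "(x(k := t)) ` {..<Suc k} = insert t (x ` {..<k})"
    by (auto simp: lessThan_Suc)
  show ?case
  proof (intro exI[of _ "x(k := t)"] conjI)
    show "mpoly_eval (\<lambda>(i, j). (x(k := t)) i j) F \<noteq> 0" using t(1) by (simp add: h_def)
    show "mpoly.dim (vanishing_forms n d ((x(k := t)) ` {..<Suc k})) \<le> num_forms n d - Suc k"
      unfolding img using g(4)[rule_format, of t] t(2) x(4) by auto
    show "mpoly.dim (vanishing_forms n (d - 1) ((x(k := t)) ` {..<Suc k})) \<le> num_forms n (d - 1) - Suc k"
      unfolding img using g'(4)[rule_format, of t] t(2) x(5) by auto
  qed (use x t t0 in \<open>auto simp: less_Suc_eq\<close>)
qed

text \<open>A tuple in the open set \<open>U\<close> violates one of the equations of the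
  complement, say \<open>F\<close>. Conversely, a tuple with representatives at which
  \<open>F\<close> is nonzero lies in \<open>U\<close>, so it is enough to keep \<open>F\<close>
  nonzero while the points are replaced.\<close>

lemma general_points_with_small_vanishing_forms:
  assumes n: "1 \<le> n" and d: "1 \<le> d" and gen: "for_general_points n s Q"
  obtains X Z where "Q Z" "X \<subseteq> \<Union>Z"
    "mpoly.dim (vanishing_forms n d X) \<le> num_forms n d - s"
    "mpoly.dim (vanishing_forms n (d - 1) X) \<le> num_forms n (d - 1) - s"
proof -
  obtain U where U: "zariski_open_tuples n s U" "U \<noteq> {}" "\<forall>P\<in>U. Q (P ` {..<s})"
    using gen by (auto simp: for_general_points_def)
  then obtain G where G: "U \<subseteq> proj_tuples n s" "G \<subseteq> multiforms n s"
    "proj_tuples n s - U = {P \<in> proj_tuples n s.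
        \<forall>f\<in>G. \<forall>x. (\<forall>i<s. x i \<in> P i) \<longrightarrow> mpoly_eval (\<lambda>(i, j). x i j) f = 0}"
    by (auto simp: zariski_open_tuples_def zariski_closed_tuples_def)
  obtain P where P: "P \<in> U" using U(2) by auto
  then have "P \<in> proj_tuples n s" "P \<notin> proj_tuples n s - U" using G(1) by auto
  then obtain F y where F: "F \<in> G" "\<forall>i<s. y i \<in> P i" "mpoly_eval (\<lambda>(i, j). y i j) F \<noteq> 0"
    unfolding G(3) by blast
  \<comment> \<open>The values \<open>y i\<close> with \<open>i \<ge> s\<close> are arbitrary, but
    zero coordinates from \<open>n\<close> onwards are demanded in every row. Since \<open>F\<close>
    involves only the first \<open>s\<close> rows, the others may be set to zero.\<close>
  define y' where "y' i = (if i < s then y i else (\<lambda>_. 0))" for i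
  have "y i j = 0" if "i < s" "j \<ge> n" for i j
  proof -
    have "P i \<in> proj_space n" using \<open>P \<in> proj_tuples n s\<close> that by (auto simp: proj_tuples_def)
    then show ?thesis using F(2) that by (fastforce simp: proj_space_def)
  qed
  then have y'0: "\<forall>i. \<forall>j\<ge>n. y' i j = 0" by (simp add: y'_def)
  have "mpoly_eval (\<lambda>(i, j). y' i j) F = mpoly_eval (\<lambda>(i, j). y i j) F"
    unfolding mpoly_eval_def
  proof (intro sum.cong refl arg_cong2[where f = "(*)"] prod.cong)
    fix m v assume mv: "m \<in> Poly_Mapping.keys F" "v \<in> Poly_Mapping.keys m"
    then have "v \<in> {..<s} \<times> {..<n}"
      using F(1) G(2) unfolding multiforms_def by blast
    then show "(case v of (i, j) \<Rightarrow> y' i j) ^ Poly_Mapping.lookup m v =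
        (case v of (i, j) \<Rightarrow> y i j) ^ Poly_Mapping.lookup m v"
      by (auto simp: y'_def)
  qed
  then have y'F: "mpoly_eval (\<lambda>(i, j). y' i j) F \<noteq> 0" using F(3) by simp
  obtain x where x: "\<forall>i. \<forall>j\<ge>n. x i j = 0" "mpoly_eval (\<lambda>(i, j). x i j) F \<noteq> 0"
    "\<forall>i<s. x i \<noteq> (\<lambda>_. 0)"
    "mpoly.dim (vanishing_forms n d (x ` {..<s})) \<le> num_forms n d - s"
    "mpoly.dim (vanishing_forms n (d - 1) (x ` {..<s})) \<le> num_forms n (d - 1) - s"
    using generic_points_exist[OF n d y'0 y'F, of s] by blast
  define R where "R = (\<lambda>i\<in>{..<s}. {(\<lambda>j. c * x i j) | c. c \<noteq> 0})"
  have xR: "x i \<in> R i" if "i < s" for i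
    using that by (auto simp: R_def intro: exI[of _ 1])
  have "R \<in> proj_tuples n s"
    using x(1,3) by (auto simp: R_def proj_tuples_def proj_space_def)
  moreover have "R \<notin> proj_tuples n s - U"
    unfolding G(3) using F(1) x(2) xR by blast
  ultimately have "R \<in> U" by simp
  then have "Q (R ` {..<s})" using U(3) by blast
  moreover have "x ` {..<s} \<subseteq> \<Union>(R ` {..<s})" using xR by auto
  ultimately show thesis using that x(4,5) by blast
qed

section \<open>The square of the vanishing ideal in degree \<open>2d\<close>\<close>

lemma carrier_mpoly_ring: "carrier (mpoly_ring n) = {p. \<forall>m\<in>Poly_Mapping.keys p. Poly_Mapping.keys m \<subseteq> {..<n}}"
  by (simp add: mpoly_ring_def)

lemma mult_mpoly_ring [simp]: "p \<otimes>\<^bsub>mpoly_ring n\<^esub> q = p * q"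
  and add_mpoly_ring [simp]: "p \<oplus>\<^bsub>mpoly_ring n\<^esub> q = p + q"
  and zero_mpoly_ring [simp]: "\<zero>\<^bsub>mpoly_ring n\<^esub> = 0"
  by (simp_all add: mpoly_ring_def)

lemma uminus_mpoly_ring:
  assumes "p \<in> carrier (mpoly_ring n)"
  shows "\<ominus>\<^bsub>mpoly_ring n\<^esub> p = - p"
proof -
  interpret cring "mpoly_ring n" by (rule cring_mpoly_ring)
  show ?thesis
    using assms by (intro minus_equality) (auto simp: carrier_mpoly_ring)
qed

text \<open>A monomial times a form vanishing on \<open>X\<close> is again such a form, and
  linearity does the rest. As an ideal, the span contains \<open>vanishing_ideal n Z\<close>
  whenever \<open>X \<subseteq> \<Union>Z\<close>, which makes the elements of the latter linear
  combinations of forms vanishing on \<open>X\<close>.\<close>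

lemma ideal_span_vanishing_forms:
  "ideal (mpoly.span (\<Union>e. vanishing_forms n e X)) (mpoly_ring n)" (is "ideal ?J _")
proof -
  interpret cring "mpoly_ring n" by (rule cring_mpoly_ring)
  have sub: "mpoly.subspace (carrier (mpoly_ring n))"
  proof (rule mpoly.subspaceI)
    show "mpoly_scale c x \<in> carrier (mpoly_ring n)" if "x \<in> carrier (mpoly_ring n)" for c x
      using that keys_mpoly_scale[of c x] by (fastforce simp: carrier_mpoly_ring)
    show "x + y \<in> carrier (mpoly_ring n)"
      if "x \<in> carrier (mpoly_ring n)" "y \<in> carrier (mpoly_ring n)" for x y
      using that Poly_Mapping.keys_add[of x y] by (fastforce simp: carrier_mpoly_ring)
  qed (simp add: carrier_mpoly_ring)
  have carr: "?J \<subseteq> carrier (mpoly_ring n)"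
    by (rule mpoly.span_minimal[OF _ sub]) (auto simp: vanishing_forms_def forms_def)
  have single: "Poly_Mapping.single m c * a \<in> ?J"
    if m: "Poly_Mapping.keys m \<subseteq> {..<n}" and a: "a \<in> ?J" for m c a
    using a
  proof (induction rule: mpoly.span_induct_alt)
    case (step k v w)
    then obtain e where v: "v \<in> vanishing_forms n e X" by auto
    define e' where "e' = (\<Sum>i<n. Poly_Mapping.lookup m i)"
    have "Poly_Mapping.single m (k * c) \<in> forms n e'" using m by (auto simp: forms_iff e'_def)
    then have "Poly_Mapping.single m (k * c) * v \<in> vanishing_forms n (e' + e) X"
      using v forms_mult by (auto simp: vanishing_forms_def mpoly_eval_mult)
    then have "Poly_Mapping.single m (k * c) * v \<in> ?J" by (blast intro: mpoly.span_base)
    moreover have "Poly_Mapping.single m c * Poly_Mapping.single 0 k = Poly_Mapping.single m (k * c)"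
      by (simp add: mult_single mult.commute)
    then have "Poly_Mapping.single m c * mpoly_scale k v = Poly_Mapping.single m (k * c) * v"
      by (simp add: mpoly_scale_def flip: mult.assoc)
    ultimately show ?case
      using step by (simp add: distrib_left mpoly.span_add)
  qed (simp add: mpoly.span_zero)
  have mult: "p * a \<in> ?J" if p: "p \<in> carrier (mpoly_ring n)" and a: "a \<in> ?J" for p a
  proof -
    have "(\<Sum>m\<in>Poly_Mapping.keys p. Poly_Mapping.single m (Poly_Mapping.lookup p m) * a) \<in> ?J"
      using p a by (intro mpoly.span_sum single) (auto simp: carrier_mpoly_ring)
    then show ?thesis by (simp flip: sum_distrib_right mpoly_sum_single)
  qed
  show ?thesis
  proof (rule idealI)
    show "subgroup ?J (add_monoid (mpoly_ring n))"
    proof (rule add.subgroupI)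
      show "\<ominus>\<^bsub>mpoly_ring n\<^esub> a \<in> ?J" if "a \<in> ?J" for a
        using that carr by (subst uminus_mpoly_ring) (auto simp: mpoly.span_neg)
    qed (use carr mpoly.span_zero in \<open>auto simp: mpoly.span_add\<close>)
    show "x \<otimes>\<^bsub>mpoly_ring n\<^esub> a \<in> ?J" "a \<otimes>\<^bsub>mpoly_ring n\<^esub> x \<in> ?J"
      if "a \<in> ?J" "x \<in> carrier (mpoly_ring n)" for a x
      using mult[OF that(2,1)] by (simp_all add: mult.commute)
  qed (rule ring_axioms)
qed

definition homogeneous_part :: "nat \<Rightarrow> nat \<Rightarrow> nat mpoly \<Rightarrow> nat mpoly" where
  "homogeneous_part n e p = (\<Sum>m | m \<in> Poly_Mapping.keys p \<and> (\<Sum>i<n. Poly_Mapping.lookup m i) = e.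
     Poly_Mapping.single m (Poly_Mapping.lookup p m))"

lemma lookup_homogeneous_part:
  "Poly_Mapping.lookup (homogeneous_part n e p) m =
     (if (\<Sum>i<n. Poly_Mapping.lookup m i) = e then Poly_Mapping.lookup p m else 0)"
proof -
  have "Poly_Mapping.lookup (homogeneous_part n e p) m
      = (\<Sum>k | k \<in> Poly_Mapping.keys p \<and> (\<Sum>i<n. Poly_Mapping.lookup k i) = e.
          if k = m then Poly_Mapping.lookup p m else 0)"
    unfolding homogeneous_part_def lookup_sum
    by (intro sum.cong) (auto simp: lookup_single when_def)
  also have "\<dots> = (if (\<Sum>i<n. Poly_Mapping.lookup m i) = e then Poly_Mapping.lookup p m else 0)"
    by (auto simp: in_keys_iff)
  finally show ?thesis .
qed

lemma homogeneous_part_add: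
  "homogeneous_part n e (p + q) = homogeneous_part n e p + homogeneous_part n e q"
  by (rule poly_mapping_eqI) (simp add: lookup_homogeneous_part lookup_add)

lemma lookup_mpoly_scale: "Poly_Mapping.lookup (mpoly_scale c p) m = c * Poly_Mapping.lookup p m"
  by (cases "c = 0")
    (auto simp: mpoly_scale_def map.rep_eq when_def simp flip: mult_map_scale_conv_mult)

lemma homogeneous_part_scale:
  "homogeneous_part n e (mpoly_scale c p) = mpoly_scale c (homogeneous_part n e p)"
  by (rule poly_mapping_eqI) (simp add: lookup_homogeneous_part lookup_mpoly_scale)

lemma homogeneous_part_form:
  assumes "p \<in> forms n d"
  shows "homogeneous_part n e p = (if d = e then p else 0)"
  using assms by (intro poly_mapping_eqI) (auto simp: lookup_homogeneous_part forms_iff in_keys_iff)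

text \<open>Multiplication by the \<open>k\<close>-th power of the first variable preserves
  vanishing and is injective.\<close>

lemma vanishing_forms_lower_degree:
  assumes n: "1 \<le> n" and "vanishing_forms n (e + k) X \<subseteq> {0}"
  shows "vanishing_forms n e X \<subseteq> {0}"
proof
  fix f assume f: "f \<in> vanishing_forms n e X"
  let ?x = "Poly_Mapping.single (Poly_Mapping.single 0 k) 1 :: nat mpoly"
  have "f * ?x \<in> vanishing_forms n (e + k) X"
    using f forms_mult monomial_form[OF n] by (auto simp: vanishing_forms_def mpoly_eval_mult)
  then have "f * ?x = 0" using assms by auto
  moreover have "?x \<noteq> 0" by (auto simp flip: keys_eq_empty)
  ultimately show "f \<in> {0}" by simp
qed

text \<open>Elements of the ideal product are sums of products without homogeneity, so the linear
  projection \<open>homogeneous_part\<close> is applied and the products are expanded bilinearly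
  into products of forms. The inclusion bounds the dimension from above by a number of
  products.\<close>

lemma square_of_vanishing_ideal_subset:
  assumes X: "X \<subseteq> \<Union>Z" and low: "\<And>e. e < d \<Longrightarrow> vanishing_forms n e X \<subseteq> {0}"
  shows "ideal_prod (mpoly_ring n) (vanishing_ideal n Z) (vanishing_ideal n Z) \<inter> forms n (2 * d)
    \<subseteq> mpoly.span {f * g | f g. f \<in> vanishing_forms n d X \<and> g \<in> vanishing_forms n d X}"
    (is "ideal_prod _ ?I ?I \<inter> _ \<subseteq> ?S")
proof
  interpret cring "mpoly_ring n" by (rule cring_mpoly_ring)
  have I: "?I \<subseteq> mpoly.span (\<Union>e. vanishing_forms n e X)"
    unfolding vanishing_ideal_def using X
    by (intro genideal_minimal[OF ideal_span_vanishing_forms])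
       (auto simp: vanishing_forms_def intro!: mpoly.span_base)
  have part_prod: "homogeneous_part n (2 * d) (a * b) \<in> ?S"
    if a: "a \<in> mpoly.span (\<Union>e. vanishing_forms n e X)"
      and b: "b \<in> mpoly.span (\<Union>e. vanishing_forms n e X)" for a b
    using a
  proof (induction rule: mpoly.span_induct_alt)
    case (step k v w)
    then obtain i where v: "v \<in> vanishing_forms n i X" by auto
    have "homogeneous_part n (2 * d) (v * b) \<in> ?S"
      using b
    proof (induction rule: mpoly.span_induct_alt)
      case (step l u z)
      then obtain j where u: "u \<in> vanishing_forms n j X" by auto
      have "v * u \<in> forms n (i + j)" using u v forms_mult by (auto simp: vanishing_forms_def)
      then have part: "homogeneous_part n (2 * d) (v * u) = (if i + j = 2 * d then v * u else 0)"
        by (rule homogeneous_part_form)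
      have "homogeneous_part n (2 * d) (v * u) \<in> ?S"
      proof (cases "i = d \<and> j = d")
        case True
        then show ?thesis using u v part by (auto intro!: mpoly.span_base)
      next
        case False
        \<comment> \<open>In total degree \<open>2 * d\<close>, degrees other than
          \<open>(d, d)\<close> force one factor below degree \<open>d\<close>, and that factor is
          zero by \<open>low\<close>.\<close>
        then have "i + j \<noteq> 2 * d \<or> i < d \<or> j < d" by auto
        then have "homogeneous_part n (2 * d) (v * u) = 0" using low u v part by fastforce
        then show ?thesis by (simp add: mpoly.span_zero)
      qed
      moreover have "v * (mpoly_scale l u + z) = mpoly_scale l (v * u) + v * z"
        by (simp add: mpoly_scale_def algebra_simps)
      ultimately show ?case using step
        by (simp add: homogeneous_part_add homogeneous_part_scale mpoly.span_add mpoly.span_scale)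
    qed (simp add: homogeneous_part_def mpoly.span_zero)
    moreover have "(mpoly_scale k v + w) * b = mpoly_scale k (v * b) + w * b"
      by (simp add: mpoly_scale_def algebra_simps)
    ultimately show ?case using step
      by (simp add: homogeneous_part_add homogeneous_part_scale mpoly.span_add mpoly.span_scale)
  qed (simp add: homogeneous_part_def mpoly.span_zero)
  have part: "homogeneous_part n (2 * d) f \<in> ?S" if "f \<in> ideal_prod (mpoly_ring n) ?I ?I" for f
    using that
  proof induction
    case (prod i j)
    then show ?case using I part_prod[of i j] by auto
  next
    case (sum s1 s2)
    then show ?case by (simp add: homogeneous_part_add mpoly.span_add)
  qed
  fix f assume f: "f \<in> ideal_prod (mpoly_ring n) ?I ?I \<inter> forms n (2 * d)"
  then have "homogeneous_part n (2 * d) f = f"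
    using homogeneous_part_form[of f n "2 * d" "2 * d"] by simp
  then show "f \<in> ?S" using part[of f] f by auto
qed

text \<open>Scaling by a real number is multiplication by a constant of the ring, so ideals are
  subspaces.\<close>

lemma subspace_square_of_vanishing_ideal:
  "mpoly.subspace (ideal_prod (mpoly_ring n) (vanishing_ideal n Z) (vanishing_ideal n Z) \<inter> forms n e)"
    (is "mpoly.subspace (?J \<inter> _)")
proof -
  interpret cring "mpoly_ring n" by (rule cring_mpoly_ring)
  have "ideal (vanishing_ideal n Z) (mpoly_ring n)"
    unfolding vanishing_ideal_def by (intro genideal_ideal) (auto simp: forms_def)
  then interpret J: ideal ?J "mpoly_ring n" by (intro ideal_prod_is_ideal)
  have "mpoly.subspace ?J"
  proof (rule mpoly.subspaceI)
    show "0 \<in> ?J" using J.zero_closed by simp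
    show "x + y \<in> ?J" if "x \<in> ?J" "y \<in> ?J" for x y
      using J.a_closed[OF that] by simp
    show "mpoly_scale c x \<in> ?J" if "x \<in> ?J" for c x
      using J.I_l_closed[OF that, of "Poly_Mapping.single 0 c"]
      by (simp add: mpoly_scale_def carrier_mpoly_ring)
  qed
  then show ?thesis using subspace_forms by (rule mpoly.subspace_inter)
qed

section \<open>Gram matrices\<close>

abbreviation const_poly :: "real \<Rightarrow> 'v mpoly" where
  "const_poly \<equiv> Poly_Mapping.single 0"

lemma const_poly_add: "const_poly (a + b) = const_poly a + const_poly b"
  by (rule single_add)

lemma const_poly_mult: "const_poly (a * b) = const_poly a * const_poly b"
  by (simp add: mult_single)

lemma const_poly_sum: "const_poly (\<Sum>i\<in>I. f i) = (\<Sum>i\<in>I. const_poly (f i))"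
  by (induction I rule: infinite_finite_induct) (auto simp: single_add)

lemma is_sos_of_length_mono:
  assumes "is_sos_of_length n d f r" "r \<le> s"
  shows "is_sos_of_length n d f s"
proof -
  obtain p where p: "\<forall>i<r. p i \<in> forms n d" "f = (\<Sum>i<r. (p i)\<^sup>2)"
    using assms(1) by (auto simp: is_sos_of_length_def)
  define q where "q i = (if i < r then p i else 0)" for i
  have "(\<Sum>i<s. (q i)\<^sup>2) = (\<Sum>i<r. (q i)\<^sup>2)"
    using assms(2) by (intro sum.mono_neutral_right) (auto simp: q_def)
  then have "f = (\<Sum>i<s. (q i)\<^sup>2)" using p(2) by (simp add: q_def)
  moreover have "\<forall>i<s. q i \<in> forms n d"
    using p(1) mpoly.subspace_0[OF subspace_forms] by (auto simp: q_def)
  ultimately show ?thesis unfolding is_sos_of_length_def by blast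
qed

lemma is_sos_of_length_add_square:
  assumes "is_sos_of_length n d f r" "q \<in> forms n d"
  shows "is_sos_of_length n d (f + q\<^sup>2) (Suc r)"
proof -
  obtain p where p: "\<forall>i<r. p i \<in> forms n d" "f = (\<Sum>i<r. (p i)\<^sup>2)"
    using assms(1) by (auto simp: is_sos_of_length_def)
  then have "f + q\<^sup>2 = (\<Sum>i<Suc r. ((p(r := q)) i)\<^sup>2)" by simp
  moreover have "\<forall>i<Suc r. (p(r := q)) i \<in> forms n d"
    using p(1) assms(2) by (auto simp: less_Suc_eq)
  ultimately show ?thesis unfolding is_sos_of_length_def by blast
qed

section \<open>Quadratic forms and positive semidefiniteness\<close>

definition bilin :: "'i set \<Rightarrow> ('i \<Rightarrow> 'i \<Rightarrow> real) \<Rightarrow> ('i \<Rightarrow> real) \<Rightarrow> ('i \<Rightarrow> real) \<Rightarrow> real" where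
  "bilin I M x y = (\<Sum>i\<in>I. \<Sum>j\<in>I. M i j * (x i * y j))"

text \<open>Symmetry is demanded for all indices and not only on \<open>I\<close>, so rewriting with
  it carries no membership conditions, even after \<open>I\<close> shrinks.\<close>

definition psd_on :: "'i set \<Rightarrow> ('i \<Rightarrow> 'i \<Rightarrow> real) \<Rightarrow> bool" where
  "psd_on I M \<longleftrightarrow> (\<forall>i j. M i j = M j i) \<and> (\<forall>x. 0 \<le> bilin I M x x)"

definition unit_vec :: "'i \<Rightarrow> 'i \<Rightarrow> real" where
  "unit_vec k i = (if i = k then 1 else 0)"

lemma bilin_add_scale:
  "bilin I M (\<lambda>i. x i + c * y i) z = bilin I M x z + c * bilin I M y z"
  "bilin I M z (\<lambda>i. x i + c * y i) = bilin I M z x + c * bilin I M z y"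
  by (simp_all add: bilin_def sum_distrib_left sum.distrib algebra_simps)

lemma bilin_commute:
  assumes "\<And>i j. M i j = M j i"
  shows "bilin I M x y = bilin I M y x"
  unfolding bilin_def by (subst sum.swap) (simp add: assms mult.commute)

lemma bilin_unit_vec:
  assumes "finite I" "k \<in> I"
  shows "bilin I M (unit_vec k) y = (\<Sum>j\<in>I. M k j * y j)"
proof -
  have "bilin I M (unit_vec k) y = (\<Sum>i\<in>I. if i = k then \<Sum>j\<in>I. M k j * y j else 0)"
    unfolding bilin_def unit_vec_def by (intro sum.cong) auto
  then show ?thesis using assms by simp
qed

lemma bilin_unit_vecs:
  assumes "finite I" "k \<in> I" "l \<in> I"
  shows "bilin I M (unit_vec k) (unit_vec l) = M k l"
proof -
  have "bilin I M (unit_vec k) (unit_vec l) = (\<Sum>j\<in>I. if j = l then M k l else 0)"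
    unfolding bilin_unit_vec[OF assms(1,2)] unit_vec_def by (intro sum.cong) auto
  then show ?thesis using assms by simp
qed

lemma bilin_square_add_scale:
  assumes "\<And>i j. M i j = M j i"
  shows "bilin I M (\<lambda>i. x i + c * y i) (\<lambda>i. x i + c * y i)
    = bilin I M x x + 2 * c * bilin I M x y + c\<^sup>2 * bilin I M y y"
  using bilin_commute[of M I x y, OF assms]
  by (simp add: bilin_add_scale power2_eq_square algebra_simps)

lemma psd_on_subset:
  fixes I J :: "'i set"
  assumes "finite I" "J \<subseteq> I" "psd_on I M"
  shows "psd_on J M"
  unfolding psd_on_def
proof (intro conjI allI)
  show "M i j = M j i" for i j using assms(3) unfolding psd_on_def by blast
  fix x :: "'i \<Rightarrow> real"
  define y where "y i = (if i \<in> J then x i else 0)" for i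
  have "bilin I M y y = bilin J M y y"
    unfolding bilin_def using assms(1,2)
    by (intro sum.mono_neutral_cong_right) (auto simp: y_def intro!: sum.mono_neutral_right)
  also have "\<dots> = bilin J M x x" by (simp add: bilin_def y_def cong: sum.cong)
  finally show "0 \<le> bilin J M x x" using assms(3) unfolding psd_on_def by metis
qed

text \<open>An isotropic vector of a semidefinite form lies in the kernel: at
  \<open>unit_vec k + y * v\<close> the quadratic form is affine in \<open>y\<close>, and a
  nonnegative affine function has slope 0.\<close>

lemma psd_kernel:
  assumes I: "finite I" and M: "psd_on I M" and v: "bilin I M v v = 0" and k: "k \<in> I"
  shows "(\<Sum>j\<in>I. M k j * v j) = 0"
proof -
  define b where "b = (\<Sum>j\<in>I. M k j * v j)"
  have sym: "M i j = M j i" for i j using M unfolding psd_on_def by blast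
  have nonneg: "0 \<le> M k k + 2 * y * b" for y
  proof -
    have "0 \<le> bilin I M (\<lambda>i. unit_vec k i + y * v i) (\<lambda>i. unit_vec k i + y * v i)"
      using M unfolding psd_on_def by blast
    then show ?thesis
      by (simp add: bilin_square_add_scale[of M, OF sym] v bilin_unit_vecs[OF I k k] bilin_unit_vec[OF I k, of M v] b_def)
  qed
  have "b = 0"
  proof (rule ccontr)
    assume "b \<noteq> 0"
    \<comment> \<open>This \<open>y\<close> gives the negative value
      \<open>M k k - 2 * (\<bar>M k k\<bar> + 1)\<close>.\<close>
    then show False using nonneg[of "- (\<bar>M k k\<bar> + 1) / b"] abs_ge_self[of "M k k"] abs_ge_zero[of "M k k"] by simp
  qed
  then show ?thesis by (simp add: b_def)
qed

lemma double_sum_insert: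
  fixes G :: "'i \<Rightarrow> 'i \<Rightarrow> 'a::comm_ring_1"
  assumes "finite I" "k \<notin> I" "\<And>i. i \<in> I \<Longrightarrow> G i k = G k i"
  shows "(\<Sum>i\<in>insert k I. \<Sum>j\<in>insert k I. G i j)
    = G k k + 2 * (\<Sum>i\<in>I. G k i) + (\<Sum>i\<in>I. \<Sum>j\<in>I. G i j)"
proof -
  have "(\<Sum>i\<in>I. G i k) = (\<Sum>i\<in>I. G k i)" using assms(3) by (intro sum.cong) auto
  then show ?thesis using assms(1,2) by (simp add: sum.distrib algebra_simps)
qed

section \<open>Sums of squares from Gram matrices\<close>

definition gram_form :: "'i set \<Rightarrow> ('i \<Rightarrow> 'i \<Rightarrow> real) \<Rightarrow> ('i \<Rightarrow> 'v mpoly) \<Rightarrow> 'v mpoly" where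
  "gram_form I M p = (\<Sum>i\<in>I. \<Sum>j\<in>I. const_poly (M i j) * (p i * p j))"

text \<open>A vector \<open>x\<close> on \<open>I\<close> is extended to \<open>k\<close> by
  \<open>- s / M k k\<close>, the value that minimizes the quadratic form. The minimum is the value
  of the Schur complement at \<open>x\<close>.\<close>

lemma psd_schur_complement:
  assumes I: "finite I" "k \<notin> I" and M: "psd_on (insert k I) M" and Mkk: "M k k \<noteq> 0"
  shows "psd_on I (\<lambda>i j. M i j - M k i * M k j / M k k)"
  unfolding psd_on_def
proof (intro conjI allI)
  have sym: "M i j = M j i" for i j using M unfolding psd_on_def by blast
  show "M i j - M k i * M k j / M k k = M j i - M k j * M k i / M k k" for i j
    by (simp add: sym mult.commute)
  fix x
  define s where "s = (\<Sum>i\<in>I. M k i * x i)"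
  define y where "y = x(k := - s / M k k)"
  have yI: "y i = x i" if "i \<in> I" for i using that I by (auto simp: y_def)
  have s2: "(\<Sum>i\<in>I. \<Sum>j\<in>I. M k i * M k j * (x i * x j)) = s * s"
    unfolding s_def sum_product by (simp add: algebra_simps)
  have "bilin (insert k I) M y y
      = M k k * (y k * y k) + 2 * (\<Sum>i\<in>I. M k i * (y k * y i)) + bilin I M x x"
    unfolding bilin_def
    by (subst double_sum_insert[OF I]) (simp_all add: sym mult.commute yI cong: sum.cong)
  also have "(\<Sum>i\<in>I. M k i * (y k * y i)) = y k * s"
    by (simp add: s_def sum_distrib_left yI algebra_simps cong: sum.cong)
  also have "M k k * (y k * y k) + 2 * (y k * s) + bilin I M x x = bilin I M x x - s * s / M k k"
    using Mkk by (simp add: y_def field_simps)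
  also have "\<dots> = bilin I (\<lambda>i j. M i j - M k i * M k j / M k k) x x"
    unfolding bilin_def left_diff_distrib sum_subtractf s2[symmetric] by (simp add: sum_divide_distrib)
  finally show "0 \<le> bilin I (\<lambda>i j. M i j - M k i * M k j / M k k) x x"
    using M unfolding psd_on_def by metis
qed

text \<open>The right-hand side is grouped for \<open>s\<close> the root of \<open>M k k\<close> and
  \<open>c\<close> its reciprocal: \<open>s * s\<close> becomes \<open>M k k\<close> and
  \<open>(s * s) * c\<close> becomes 1.\<close>

lemma square_of_scaled_sum:
  fixes s a c L :: "'a::comm_ring_1"
  shows "(s * (a + c * L))\<^sup>2 = (s * s) * (a * a) + 2 * ((s * s) * c) * (a * L) + ((s * s) * c) * (c * (L * L))"
  by (simp add: power2_eq_square algebra_simps)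

lemma gram_form_complete_square:
  assumes I: "finite I" "k \<notin> I" and sym: "\<And>i j. M i j = M j i" and Mkk: "M k k > 0"
  shows "gram_form (insert k I) M p = gram_form I (\<lambda>i j. M i j - M k i * M k j / M k k) p +
    (const_poly (sqrt (M k k)) * (p k + const_poly (1 / M k k) * (\<Sum>i\<in>I. const_poly (M k i) * p i)))\<^sup>2"
proof -
  define L where "L = (\<Sum>i\<in>I. const_poly (M k i) * p i)"
  have 1: "gram_form (insert k I) M p
      = const_poly (M k k) * (p k * p k) + 2 * (p k * L) + gram_form I M p"
    unfolding gram_form_def L_def sum_distrib_left
    by (subst double_sum_insert[OF I]) (simp_all add: sym sum_distrib_left algebra_simps)
  have e: "const_poly (M k i * M k j / M k k) * (p i * p j) =
      const_poly (1 / M k k) * (const_poly (M k i) * p i * (const_poly (M k j) * p j))" for i j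
  proof -
    have "const_poly (M k i * M k j / M k k) * (p i * p j)
        = const_poly (1 / M k k) * (const_poly (M k i) * const_poly (M k j)) * (p i * p j)"
      by (simp flip: const_poly_mult)
    also have "\<dots> = const_poly (1 / M k k) * (const_poly (M k i) * p i * (const_poly (M k j) * p j))"
      by (simp only: ac_simps)
    finally show ?thesis .
  qed
  have "(\<Sum>i\<in>I. \<Sum>j\<in>I. const_poly (M k i * M k j / M k k) * (p i * p j)) = const_poly (1 / M k k) * (L * L)"
    unfolding e L_def sum_product by (simp only: sum_distrib_left)
  then have 2: "gram_form I (\<lambda>i j. M i j - M k i * M k j / M k k) p
      = gram_form I M p - const_poly (1 / M k k) * (L * L)"
    by (simp add: gram_form_def single_diff left_diff_distrib sum_subtractf)
  have s: "const_poly (sqrt (M k k)) * const_poly (sqrt (M k k)) = const_poly (M k k)"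
    using Mkk by (simp flip: const_poly_mult)
  have c: "const_poly (M k k) * const_poly (1 / M k k) = 1"
    using Mkk by (simp flip: const_poly_mult)
  have "(const_poly (sqrt (M k k)) * (p k + const_poly (1 / M k k) * L))\<^sup>2
      = (const_poly (sqrt (M k k)) * const_poly (sqrt (M k k))) * (p k * p k)
        + 2 * ((const_poly (sqrt (M k k)) * const_poly (sqrt (M k k))) * const_poly (1 / M k k)) * (p k * L)
        + ((const_poly (sqrt (M k k)) * const_poly (sqrt (M k k))) * const_poly (1 / M k k)) * (const_poly (1 / M k k) * (L * L))"
    by (rule square_of_scaled_sum)
  then have 3: "(const_poly (sqrt (M k k)) * (p k + const_poly (1 / M k k) * L))\<^sup>2
      = const_poly (M k k) * (p k * p k) + 2 * (p k * L) + const_poly (1 / M k k) * (L * L)"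
    by (simp only: s c) simp
  show ?thesis using 1 2 3 by (simp add: L_def)
qed

lemma const_poly_mult_form:
  assumes "p \<in> forms n d"
  shows "const_poly c * p \<in> forms n d"
  using mpoly.subspace_scale[OF subspace_forms assms, of c] by (simp add: mpoly_scale_def)

text \<open>Cholesky decomposition by induction on the index set: completing the square in
  \<open>p k\<close> splits off one square and leaves the Schur complement on the remaining
  indices.\<close>

lemma psd_gram_form_sos:
  assumes "finite I" "psd_on I M" "\<And>i. i \<in> I \<Longrightarrow> p i \<in> forms n d"
  shows "is_sos_of_length n d (gram_form I M p) (card I)"
  using assms
proof (induction I arbitrary: M)
  case empty
  then show ?case by (simp add: gram_form_def is_sos_of_length_def)
next
  case (insert k I)
  have sym: "M i j = M j i" for i j using insert.prems(1) unfolding psd_on_def by blast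
  have fin: "finite (insert k I)" and kI: "k \<in> insert k I" using insert.hyps by auto
  show ?case
  proof (cases "M k k = 0")
    case True
    \<comment> \<open>A zero diagonal entry makes \<open>unit_vec k\<close> isotropic, so the row
      and the column of \<open>k\<close> vanish and the index drops out.\<close>
    then have "bilin (insert k I) M (unit_vec k) (unit_vec k) = 0"
      using bilin_unit_vecs[OF fin kI kI] by simp
    then have "M i k = 0" if "i \<in> insert k I" for i
      using psd_kernel[OF fin insert.prems(1) _ that, of "unit_vec k"] insert.hyps
        bilin_unit_vecs[OF fin that kI, of M] bilin_unit_vec[OF fin that, of M "unit_vec k"] by simp
    then have zero: "M i k = 0" "M k i = 0" if "i \<in> insert k I" for i
      using that sym by auto
    have "gram_form (insert k I) M p = gram_form I M p"
      unfolding gram_form_def using zero insert.hyps by simp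
    moreover have "is_sos_of_length n d (gram_form I M p) (card I)"
      using insert.prems psd_on_subset[OF fin _ insert.prems(1)] by (intro insert.IH) auto
    ultimately show ?thesis
      using is_sos_of_length_mono[of n d _ "card I" "card (insert k I)"] insert.hyps by simp
  next
    case False
    have "0 \<le> bilin (insert k I) M (unit_vec k) (unit_vec k)"
      using insert.prems(1) unfolding psd_on_def by blast
    then have pos: "M k k > 0" using False bilin_unit_vecs[OF fin kI kI, of M] by simp
    have "is_sos_of_length n d (gram_form I (\<lambda>i j. M i j - M k i * M k j / M k k) p) (card I)"
      using insert.prems(2) by (intro insert.IH psd_schur_complement[OF insert.hyps insert.prems(1) False]) auto
    moreover have "const_poly (sqrt (M k k)) *
        (p k + const_poly (1 / M k k) * (\<Sum>i\<in>I. const_poly (M k i) * p i)) \<in> forms n d"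
      using insert.prems(2)
      by (intro const_poly_mult_form mpoly.subspace_add[OF subspace_forms] mpoly.subspace_sum[OF subspace_forms]) auto
    ultimately show ?thesis
      unfolding gram_form_complete_square[of I k M p, OF insert.hyps sym pos]
      using is_sos_of_length_add_square insert.hyps by fastforce
  qed
qed

text \<open>Since \<open>v\<close> lies in the kernel of \<open>M\<close>, subtracting a common
  polynomial times \<open>v i\<close> from each \<open>p i\<close> does not change the Gram form.
  The multiple is chosen to cancel \<open>p k\<close>, which saves one square.\<close>

lemma singular_psd_gram_form_sos:
  assumes I: "finite I" and M: "psd_on I M" and p: "\<And>i. i \<in> I \<Longrightarrow> p i \<in> forms n d"
    and v: "bilin I M v v = 0" and k: "k \<in> I" "v k \<noteq> 0"
  shows "is_sos_of_length n d (gram_form I M p) (card I - 1)"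
proof -
  define u where "u = const_poly (1 / v k) * p k"
  define q where "q i = p i - const_poly (v i) * u" for i
  have qk: "q k = 0"
    using k(2) by (simp add: q_def u_def flip: mult.assoc const_poly_mult)
  have sym: "M i j = M j i" for i j using M unfolding psd_on_def by blast
  have row: "(\<Sum>j\<in>I. const_poly (M i j) * const_poly (v j)) = 0" if "i \<in> I" for i
    using psd_kernel[OF I M v that] by (simp flip: const_poly_mult const_poly_sum)
  have pq: "p i = q i + const_poly (v i) * u" for i by (simp add: q_def)
  \<comment> \<open>With \<open>p i = q i + v i * u\<close>, the product \<open>p i * p j\<close> is
    \<open>q i * q j\<close>, plus a term containing \<open>v j\<close>, which dies because
    \<open>M\<close> kills \<open>v\<close>, plus a term antisymmetric in \<open>i\<close> and
    \<open>j\<close>, which dies because \<open>M\<close> is symmetric.\<close>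
  have "gram_form I M p = (\<Sum>i\<in>I. \<Sum>j\<in>I. const_poly (M i j) * (q i * q j)
      + (p i + q i) * u * (const_poly (M i j) * const_poly (v j)))
      + (\<Sum>i\<in>I. \<Sum>j\<in>I. u * (const_poly (M i j) * (const_poly (v i) * q j - q i * const_poly (v j))))"
    unfolding gram_form_def sum.distrib[symmetric]
    by (intro sum.cong refl) (simp add: pq algebra_simps)
  also have "(\<Sum>i\<in>I. \<Sum>j\<in>I. u * (const_poly (M i j) * (const_poly (v i) * q j - q i * const_poly (v j)))) = 0"
  proof -
    have "(\<Sum>i\<in>I. \<Sum>j\<in>I. const_poly (M i j) * (const_poly (v i) * q j))
        = (\<Sum>i\<in>I. \<Sum>j\<in>I. const_poly (M i j) * (q i * const_poly (v j)))"
      by (subst sum.swap) (simp add: sym mult.commute)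
    then show ?thesis
      by (simp add: right_diff_distrib sum_subtractf flip: sum_distrib_left)
  qed
  also have "(\<Sum>i\<in>I. \<Sum>j\<in>I. const_poly (M i j) * (q i * q j)
      + (p i + q i) * u * (const_poly (M i j) * const_poly (v j))) = gram_form I M q"
    by (simp add: gram_form_def sum.distrib row flip: sum_distrib_left)
  finally have "gram_form I M p = gram_form I M q" by simp
  also have "\<dots> = gram_form (I - {k}) M q"
    unfolding gram_form_def using I qk
    by (intro sum.mono_neutral_cong_right) (auto intro!: sum.mono_neutral_right)
  finally have eq: "gram_form I M p = gram_form (I - {k}) M q" .
  have "q i \<in> forms n d" if "i \<in> I" for i
    unfolding q_def u_def
    using p that k by (intro mpoly.subspace_diff[OF subspace_forms] const_poly_mult_form) auto
  then have "is_sos_of_length n d (gram_form (I - {k}) M q) (card (I - {k}))"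
    using I psd_on_subset[OF I _ M, of "I - {k}"] by (intro psd_gram_form_sos) auto
  then show ?thesis using eq k by simp
qed

section \<open>Shortening a sum of squares by a linear relation\<close>

text \<open>For symmetric \<open>S\<close> the number \<open>l\<close> is the largest eigenvalue and
  \<open>v\<close> an eigenvector, obtained as the maximum of the quadratic form on the unit sphere;
  the vector \<open>z\<close> makes it positive.\<close>

lemma max_of_quadratic_form:
  fixes S :: "nat \<Rightarrow> nat \<Rightarrow> real"
  assumes z: "bilin {..<r} S z z > 0"
  obtains l v k where "l > 0" "bilin {..<r} S v v = l * (\<Sum>i<r. (v i)\<^sup>2)" "k < r" "v k \<noteq> 0"
    "\<And>x. bilin {..<r} S x x \<le> l * (\<Sum>i<r. (x i)\<^sup>2)"
proof -
  \<comment> \<open>Only coordinates below \<open>r\<close> enter the form. The cube also bounds the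
    others, so \<open>K\<close> is compact by Tychonoff's theorem.\<close>
  define K :: "(nat \<Rightarrow> real) set" where "K = (\<Pi>\<^sub>E i\<in>UNIV. {-1..1}) \<inter> {x. (\<Sum>i<r. (x i)\<^sup>2) = 1}"
  have "compactin (product_topology (\<lambda>i. euclidean) UNIV) ((\<Pi>\<^sub>E i\<in>UNIV. {-1..1}) :: (nat \<Rightarrow> real) set)"
    by (simp add: compactin_PiE compactin_euclidean_iff)
  then have comp: "compact ((\<Pi>\<^sub>E i\<in>UNIV. {-1..1}) :: (nat \<Rightarrow> real) set)"
    by (simp add: euclidean_product_topology compactin_euclidean_iff)
  have "closed {x :: nat \<Rightarrow> real. (\<Sum>i<r. (x i)\<^sup>2) = 1}"
    by (intro closed_Collect_eq continuous_intros) simp_all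
  then have compK: "compact K" unfolding K_def by (intro compact_Int_closed comp)
  have cont: "continuous_on K (\<lambda>x. bilin {..<r} S x x)"
    unfolding bilin_def
    by (intro continuous_intros continuous_on_subset[OF continuous_on_product_coordinates]) simp_all
  define normalize where "normalize x i = (if i < r then x i / sqrt (\<Sum>i<r. (x i)\<^sup>2) else 0)" for x :: "nat \<Rightarrow> real" and i
  have norm: "normalize x \<in> K \<and> bilin {..<r} S x x = bilin {..<r} S (normalize x) (normalize x) * (\<Sum>i<r. (x i)\<^sup>2)"
    if nz: "(\<Sum>i<r. (x i)\<^sup>2) \<noteq> 0" for x
  proof -
    define t where "t = (\<Sum>i<r. (x i)\<^sup>2)"
    have t: "t > 0" using nz unfolding t_def by (simp add: sum_nonneg less_le)
    have "(\<Sum>i<r. (normalize x i)\<^sup>2) = (\<Sum>i<r. (x i)\<^sup>2 / t)"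
      using t by (intro sum.cong) (auto simp: normalize_def power_divide t_def[symmetric])
    also have "\<dots> = 1" using t by (simp add: t_def flip: sum_divide_distrib)
    finally have one: "(\<Sum>i<r. (normalize x i)\<^sup>2) = 1" .
    have "\<bar>normalize x i\<bar> \<le> 1" for i
    proof (cases "i < r")
      case True
      then have "(normalize x i)\<^sup>2 \<le> 1"
        using member_le_sum[of i "{..<r}" "\<lambda>i. (normalize x i)\<^sup>2"] one by simp
      then show ?thesis by (simp add: abs_square_le_1)
    qed (simp add: normalize_def)
    then have "normalize x \<in> K" using one by (auto simp: K_def abs_le_iff minus_le_iff)
    moreover have "bilin {..<r} S (normalize x) (normalize x) = bilin {..<r} S x x / t"
      unfolding bilin_def sum_divide_distrib using t
      by (intro sum.cong) (auto simp: normalize_def t_def[symmetric])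
    ultimately show ?thesis using t by (simp add: t_def)
  qed
  have zero: "bilin {..<r} S x x = 0" if "(\<Sum>i<r. (x i)\<^sup>2) = 0" for x
    using that by (simp add: sum_nonneg_eq_0_iff bilin_def)
  have z0: "(\<Sum>i<r. (z i)\<^sup>2) \<noteq> 0" using z zero by force
  then have "K \<noteq> {}" using norm by blast
  then obtain v where v: "v \<in> K" "\<And>y. y \<in> K \<Longrightarrow> bilin {..<r} S y y \<le> bilin {..<r} S v v"
    using continuous_attains_sup[OF compK _ cont] by blast
  have sumv: "(\<Sum>i<r. (v i)\<^sup>2) = 1" using v(1) by (simp add: K_def)
  show thesis
  proof -
    have le: "bilin {..<r} S x x \<le> bilin {..<r} S v v * (\<Sum>i<r. (x i)\<^sup>2)" for x
    proof (cases "(\<Sum>i<r. (x i)\<^sup>2) = 0")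
      case False
      then show ?thesis using norm[OF False] v(2) by (simp add: mult_right_mono sum_nonneg)
    qed (simp add: zero)
    have "0 < bilin {..<r} S v v"
    proof (rule ccontr)
      assume "\<not> 0 < bilin {..<r} S v v"
      then have "bilin {..<r} S v v * (\<Sum>i<r. (z i)\<^sup>2) \<le> 0"
        by (intro mult_nonpos_nonneg) (simp_all add: sum_nonneg)
      then show False using le[of z] z by simp
    qed
    moreover have "\<exists>k<r. v k \<noteq> 0"
    proof (rule ccontr)
      assume "\<not> (\<exists>k<r. v k \<noteq> 0)"
      then have "(\<Sum>i<r. (v i)\<^sup>2) = 0" by (intro sum.neutral) auto
      then show False using sumv by simp
    qed
    then obtain k where "k < r" "v k \<noteq> 0" by blast
    ultimately show thesis using that[of "bilin {..<r} S v v" v k] le sumv by simp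
  qed
qed

text \<open>The right multiple of \<open>S\<close> is the reciprocal of its largest eigenvalue
  \<open>l\<close>: the identity minus \<open>S / l\<close> is semidefinite and kills an
  eigenvector. If the form of \<open>S\<close> is negative at the vector found, \<open>- S\<close>
  takes its place.\<close>

lemma gram_relation_shortens_sos:
  assumes p: "\<And>i. i < r \<Longrightarrow> p i \<in> forms n d" and sym: "\<And>i j. S i j = S j i"
    and rel: "gram_form {..<r} S p = 0" and nz: "k < r" "l < r" "S k l \<noteq> 0"
  shows "is_sos_of_length n d (\<Sum>i<r. (p i)\<^sup>2) (r - 1)"
proof -
  have main: ?thesis
    if sym: "\<And>i j. S i j = S j i" and rel: "gram_form {..<r} S p = 0" and z: "bilin {..<r} S z z > 0" for S z
  proof -
    obtain l v k where l: "l > 0" "bilin {..<r} S v v = l * (\<Sum>i<r. (v i)\<^sup>2)" "k < r" "v k \<noteq> 0"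
      "\<And>x. bilin {..<r} S x x \<le> l * (\<Sum>i<r. (x i)\<^sup>2)"
      using max_of_quadratic_form[OF z] by blast
    define M where "M i j = unit_vec i j - S i j / l" for i j
    have M: "bilin {..<r} M x x = (\<Sum>i<r. (x i)\<^sup>2) - bilin {..<r} S x x / l" for x
    proof -
      have "(\<Sum>i<r. \<Sum>j<r. unit_vec i j * (x i * x j)) = (\<Sum>i<r. (x i)\<^sup>2)"
        by (intro sum.cong) (auto simp: unit_vec_def power2_eq_square if_distrib if_distribR cong: if_cong)
      then show ?thesis
        by (simp add: bilin_def M_def left_diff_distrib sum_subtractf sum_divide_distrib)
    qed
    have "psd_on {..<r} M"
      unfolding psd_on_def
    proof (intro conjI allI)
      show "M i j = M j i" for i j by (simp add: M_def unit_vec_def sym)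
      show "0 \<le> bilin {..<r} M x x" for x using l(1) l(5)[of x] by (simp add: M field_simps)
    qed
    moreover have "bilin {..<r} M v v = 0" using l by (simp add: M)
    ultimately have "is_sos_of_length n d (gram_form {..<r} M p) (card {..<r} - 1)"
      using l(3,4) p by (intro singular_psd_gram_form_sos) auto
    moreover have "gram_form {..<r} M p = (\<Sum>i<r. (p i)\<^sup>2)"
    proof -
      have "(\<Sum>i<r. \<Sum>j<r. const_poly (unit_vec i j) * (p i * p j)) = (\<Sum>i<r. (p i)\<^sup>2)"
        by (intro sum.cong) (auto simp: unit_vec_def power2_eq_square if_distrib if_distribR cong: if_cong)
      moreover have "(\<Sum>i<r. \<Sum>j<r. const_poly (S i j / l) * (p i * p j)) = const_poly (1 / l) * gram_form {..<r} S p"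
        unfolding gram_form_def sum_distrib_left
        by (intro sum.cong refl) (simp flip: mult.assoc const_poly_mult)
      ultimately show ?thesis
        using rel by (simp add: gram_form_def M_def single_diff left_diff_distrib sum_subtractf)
    qed
    ultimately show ?thesis by simp
  qed
  \<comment> \<open>By polarization at \<open>unit_vec k\<close> and \<open>unit_vec l\<close>, a
    symmetric matrix with a nonzero entry has a nonzero quadratic form.\<close>
  obtain z where z: "bilin {..<r} S z z \<noteq> 0"
  proof (rule ccontr)
    assume "\<not> thesis"
    then have "bilin {..<r} S x x = 0" for x using that by blast
    then have "bilin {..<r} S (unit_vec k) (unit_vec l) = 0"
      using bilin_square_add_scale[of S "{..<r}" "unit_vec k" 1 "unit_vec l", OF sym] by simp
    then show False using nz by (simp add: bilin_unit_vecs)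
  qed
  show ?thesis
  proof (cases "bilin {..<r} S z z > 0")
    case True
    then show ?thesis using main sym rel by blast
  next
    case False
    show ?thesis
    proof (rule main[of "\<lambda>i j. - S i j" z])
      show "bilin {..<r} (\<lambda>i j. - S i j) z z > 0"
        using False z by (simp add: bilin_def sum_negf)
      show "gram_form {..<r} (\<lambda>i j. - S i j) p = 0"
        using rel by (simp add: gram_form_def sum_negf single_uminus)
    qed (rule arg_cong[OF sym])
  qed
qed

section \<open>Symmetric double sums over unordered pairs\<close>

definition index_pairs :: "nat \<Rightarrow> (nat \<times> nat) set" where
  "index_pairs r = {(i, j). i \<le> j \<and> j < r}"

lemma index_pairs_Suc: "index_pairs (Suc r) = index_pairs r \<union> (\<lambda>i. (i, r)) ` {..r}"
  by (auto simp: index_pairs_def)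

lemma finite_index_pairs: "finite (index_pairs r)"
proof -
  have "index_pairs r \<subseteq> {..<r} \<times> {..<r}" by (auto simp: index_pairs_def)
  then show ?thesis by (rule finite_subset) simp
qed

lemma sum_index_pairs_Suc:
  "sum g (index_pairs (Suc r)) = sum g (index_pairs r) + (\<Sum>i\<le>r. g (i, r))"
proof -
  have "index_pairs r \<inter> (\<lambda>i. (i, r)) ` {..r} = {}" by (auto simp: index_pairs_def)
  then show ?thesis
    unfolding index_pairs_Suc
    by (simp add: sum.union_disjoint finite_index_pairs sum.reindex inj_on_def)
qed

lemma card_index_pairs: "card (index_pairs r) = Suc r choose 2"
proof (induction r)
  case 0
  show ?case by (simp add: index_pairs_def)
next
  case (Suc r)
  then show ?case
    using sum_index_pairs_Suc[of "\<lambda>_. 1 :: nat" r] by (simp add: numeral_2_eq_2)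
qed

lemma sum_symmetric_index_pairs:
  fixes G :: "nat \<Rightarrow> nat \<Rightarrow> 'a::comm_ring_1"
  assumes sym: "\<And>i j. G i j = G j i"
  shows "(\<Sum>i<r. \<Sum>j<r. G i j) = (\<Sum>(i, j)\<in>index_pairs r. if i = j then G i j else 2 * G i j)"
proof (induction r)
  case 0
  show ?case by (simp add: index_pairs_def)
next
  case (Suc r)
  have "(\<Sum>i\<le>r. if i = r then G i r else 2 * G i r) = G r r + 2 * (\<Sum>i<r. G r i)"
    by (simp add: sum_distrib_left flip: lessThan_Suc_atMost) (simp add: sym)
  moreover have "(\<Sum>i<Suc r. \<Sum>j<Suc r. G i j) = G r r + 2 * (\<Sum>i<r. G r i) + (\<Sum>i<r. \<Sum>j<r. G i j)"
    unfolding lessThan_Suc by (rule double_sum_insert) (auto intro: sym)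
  ultimately show ?case using Suc.IH by (simp add: sum_index_pairs_Suc)
qed

section \<open>Upper bound for the length\<close>

lemma sos_length_upper_bound:
  assumes n: "1 \<le> n" and f: "f \<in> sos_forms n d"
  shows "Suc (sos_length n d f) choose 2 \<le> num_forms n (2 * d)"
proof (rule ccontr)
  define r where "r = sos_length n d f"
  assume "\<not> ?thesis"
  then have big: "num_forms n (2 * d) < Suc r choose 2" by (simp add: r_def)
  have "is_sos_of_length n d f r"
    unfolding r_def sos_length_def using f LeastI_ex[of "is_sos_of_length n d f"] by (auto simp: sos_forms_def)
  then obtain p where p: "\<forall>i<r. p i \<in> forms n d" "f = (\<Sum>i<r. (p i)\<^sup>2)"
    by (auto simp: is_sos_of_length_def)
  obtain T where T: "finite T" "forms n (2 * d) \<subseteq> mpoly.span T" using forms_finite_span[OF n] .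
  have prods: "(\<lambda>(i, j). p i * p j) ` index_pairs r \<subseteq> forms n (2 * d)"
    using p(1) forms_mult[of _ n d _ d] by (auto simp: index_pairs_def mult_2)
  have gt: "mpoly.dim (forms n (2 * d)) < card (index_pairs r)"
    using big by (simp add: card_index_pairs dim_forms[OF n])
  obtain c k where c: "k \<in> index_pairs r" "c k \<noteq> 0"
    "(\<Sum>i\<in>index_pairs r. mpoly_scale (c i) (case i of (i, j) \<Rightarrow> p i * p j)) = 0"
    using nontrivial_relation_if_card_gt_dim[OF finite_index_pairs prods T gt] .
  \<comment> \<open>Halving off the diagonal compensates for each unordered pair of distinct indices
    occurring twice in the double sum.\<close>
  define S where "S i j = (if i = j then c (i, j) else c (min i j, max i j) / 2)" for i j
  have sym: "S i j = S j i" for i j by (simp add: S_def min.commute max.commute)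
  have "gram_form {..<r} S p = (\<Sum>(i, j)\<in>index_pairs r. if i = j then const_poly (S i j) * (p i * p j)
      else 2 * (const_poly (S i j) * (p i * p j)))"
    unfolding gram_form_def by (rule sum_symmetric_index_pairs) (simp add: sym mult.commute)
  also have "\<dots> = (\<Sum>i\<in>index_pairs r. mpoly_scale (c i) (case i of (i, j) \<Rightarrow> p i * p j))"
  proof (rule sum.cong[OF refl])
    fix x assume "x \<in> index_pairs r"
    then obtain i j where x: "x = (i, j)" "i \<le> j" by (auto simp: index_pairs_def)
    have "2 * const_poly (c (i, j) / 2) = (const_poly (c (i, j)) :: nat mpoly)"
      by (simp only: mult_2 single_add[symmetric]) simp
    then show "(case x of (i, j) \<Rightarrow> if i = j then const_poly (S i j) * (p i * p j)
        else 2 * (const_poly (S i j) * (p i * p j))) = mpoly_scale (c x) (case x of (i, j) \<Rightarrow> p i * p j)"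
      using x by (simp add: S_def mpoly_scale_def min_def max_def flip: mult.assoc)
  qed
  finally have "gram_form {..<r} S p = 0" using c(3) by simp
  moreover obtain i j where ij: "k = (i, j)" "i \<le> j" "j < r" using c(1) by (auto simp: index_pairs_def)
  moreover have "S i j \<noteq> 0" using c(2) ij by (auto simp: S_def min_def max_def)
  ultimately have "is_sos_of_length n d f (r - 1)"
    unfolding p(2) using p(1) sym by (intro gram_relation_shortens_sos[of _ p _ _ S i j]) auto
  then have "r \<le> r - 1" unfolding r_def sos_length_def by (rule Least_le)
  \<comment> \<open>With truncated subtraction, \<open>r \<le> r - 1\<close> is absurd only for
    positive \<open>r\<close>; the pair \<open>(i, j)\<close> provides this.\<close>
  then show False using ij(3) by simp
qed

section \<open>Lower bound for the length\<close>

lemma span_image_combination: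
  fixes p :: "'i \<Rightarrow> 'v mpoly"
  assumes I: "finite I" and "x \<in> mpoly.span (p ` I)"
  obtains a where "x = (\<Sum>i\<in>I. const_poly (a i) * p i)"
proof -
  have "\<exists>a. x = (\<Sum>i\<in>I. const_poly (a i) * p i)"
    using assms(2)
  proof (induction rule: mpoly.span_induct_alt)
    case base
    show ?case by (intro exI[of _ "\<lambda>_. 0"]) simp
  next
    case (step c y z)
    then obtain k a where k: "k \<in> I" "y = p k" and a: "z = (\<Sum>i\<in>I. const_poly (a i) * p i)" by auto
    have "(\<Sum>i\<in>I. const_poly (if i = k then c else 0) * p i) = (\<Sum>i\<in>I. if i = k then const_poly c * p k else 0)"
      by (intro sum.cong) auto
    also have "\<dots> = mpoly_scale c y" using I k by (simp add: mpoly_scale_def)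
    finally have "mpoly_scale c y + z = (\<Sum>i\<in>I. const_poly ((if i = k then c else 0) + a i) * p i)"
      by (simp add: a const_poly_add distrib_right sum.distrib)
    then show ?case by (intro exI[of _ "\<lambda>i. (if i = k then c else 0) + a i"])
  qed
  then show thesis using that by blast
qed

lemma orthonormal_columns_le_rows:
  fixes A :: "nat \<Rightarrow> nat \<Rightarrow> real"
  assumes orth: "\<And>i j. i < m \<Longrightarrow> j < m \<Longrightarrow> (\<Sum>k<r. A k i * A k j) = unit_vec i j"
  shows "m \<le> r"
proof -
  \<comment> \<open>Bessel's inequality for the columns of \<open>A\<close> and the \<open>l\<close>-th unit vector\<close>
  have row: "(\<Sum>i<m. (A l i)\<^sup>2) \<le> 1" if l: "l < r" for l
  proof -
    \<comment> \<open>The orthogonal projection of the \<open>l\<close>-th unit vector to the span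
      of the columns.\<close>
    define s where "s k = (\<Sum>i<m. A l i * A k i)" for k
    have "(\<Sum>k<r. (s k)\<^sup>2) = (\<Sum>k<r. \<Sum>i<m. \<Sum>j<m. A l i * A l j * (A k i * A k j))"
      by (simp add: s_def power2_eq_square sum_product algebra_simps)
    also have "\<dots> = (\<Sum>i<m. \<Sum>k<r. \<Sum>j<m. A l i * A l j * (A k i * A k j))"
      by (rule sum.swap)
    also have "\<dots> = (\<Sum>i<m. \<Sum>j<m. \<Sum>k<r. A l i * A l j * (A k i * A k j))"
      by (intro sum.cong refl sum.swap)
    also have "\<dots> = (\<Sum>i<m. \<Sum>j<m. A l i * A l j * unit_vec i j)"
      by (intro sum.cong refl) (simp add: orth flip: sum_distrib_left)
    also have "\<dots> = (\<Sum>i<m. (A l i)\<^sup>2)"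
      by (intro sum.cong) (auto simp: unit_vec_def power2_eq_square if_distrib if_distribR cong: if_cong)
    finally have s: "(\<Sum>k<r. (s k)\<^sup>2) = (\<Sum>i<m. (A l i)\<^sup>2)" .
    have "0 \<le> (\<Sum>k<r. (unit_vec l k - s k)\<^sup>2)" by (intro sum_nonneg) simp
    also have "\<dots> = (\<Sum>k<r. (if k = l then 1 - 2 * s l else 0) + (s k)\<^sup>2)"
      by (intro sum.cong) (auto simp: unit_vec_def power2_diff)
    also have "\<dots> = 1 - 2 * s l + (\<Sum>i<m. (A l i)\<^sup>2)" using l by (simp add: sum.distrib s)
    also have "s l = (\<Sum>i<m. (A l i)\<^sup>2)" by (simp add: s_def power2_eq_square)
    finally show ?thesis by simp
  qed
  \<comment> \<open>The sum of all squared entries is \<open>m\<close> when taken by columns and at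
    most \<open>r\<close> when taken by rows.\<close>
  have "real m = (\<Sum>i<m. \<Sum>k<r. A k i * A k i)" by (simp add: orth unit_vec_def)
  also have "\<dots> = (\<Sum>k<r. \<Sum>i<m. (A k i)\<^sup>2)" by (subst sum.swap) (simp add: power2_eq_square)
  also have "\<dots> \<le> (\<Sum>k<r. 1)" by (intro sum_mono row) simp
  finally show ?thesis by simp
qed

text \<open>If \<open>A\<close> holds the coefficients of a second representation in terms of the
  \<open>p i\<close>, then \<open>G\<close>, the transpose of \<open>A\<close> times
  \<open>A\<close> minus the identity, is a relation among the products. Independence makes it zero,
  so \<open>A\<close> has \<open>m\<close> orthonormal columns with \<open>r\<close> entries
  each.\<close>

lemma sos_length_lower_bound:
  assumes p: "\<And>i. i < m \<Longrightarrow> p i \<in> vanishing_forms n d X"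
    and span: "vanishing_forms n d X \<subseteq> mpoly.span (p ` {..<m})"
    and indep: "\<forall>c. (\<Sum>k\<in>index_pairs m. mpoly_scale (c k) (case k of (i, j) \<Rightarrow> p i * p j)) = 0 \<longrightarrow>
      (\<forall>k\<in>index_pairs m. c k = 0)"
  shows "(\<Sum>i<m. (p i)\<^sup>2) \<in> sos_forms n d" "m \<le> sos_length n d (\<Sum>i<m. (p i)\<^sup>2)"
proof -
  let ?f = "\<Sum>i<m. (p i)\<^sup>2"
  have pf: "p i \<in> forms n d" if "i < m" for i using p[OF that] by (simp add: vanishing_forms_def)
  have "(p i)\<^sup>2 \<in> forms n (2 * d)" if "i < m" for i
    using forms_mult[OF pf[OF that] pf[OF that]] by (simp add: power2_eq_square mult_2)
  then have "?f \<in> forms n (2 * d)" by (intro mpoly.subspace_sum[OF subspace_forms]) auto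
  moreover have sos: "is_sos_of_length n d ?f m"
    unfolding is_sos_of_length_def using pf by blast
  ultimately show "?f \<in> sos_forms n d" by (auto simp: sos_forms_def)
  have "m \<le> r" if r: "is_sos_of_length n d ?f r" for r
  proof -
    obtain q where q: "\<forall>k<r. q k \<in> forms n d" "?f = (\<Sum>k<r. (q k)\<^sup>2)"
      using r unfolding is_sos_of_length_def by blast
    have "q k \<in> vanishing_forms n d X" if k: "k < r" for k
      unfolding vanishing_forms_def
    proof (intro CollectI conjI ballI)
      fix x assume x: "x \<in> X"
      have "mpoly_eval x ?f = 0"
        using p x by (simp add: mpoly_eval_sum power2_eq_square mpoly_eval_mult vanishing_forms_def)
      then have "(\<Sum>k<r. (mpoly_eval x (q k))\<^sup>2) = 0"
        unfolding q(2) by (simp add: mpoly_eval_sum power2_eq_square mpoly_eval_mult)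
      then show "mpoly_eval x (q k) = 0" using k by (simp add: sum_nonneg_eq_0_iff)
    qed (use q k in auto)
    then have "\<exists>a. q k = (\<Sum>i<m. const_poly (a i) * p i)" if "k < r" for k
      using span_image_combination[of "{..<m}" "q k" p] span that by blast
    then obtain A where A: "\<And>k. k < r \<Longrightarrow> q k = (\<Sum>i<m. const_poly (A k i) * p i)" by metis
    define G where "G i j = (\<Sum>k<r. A k i * A k j) - unit_vec i j" for i j
    have "?f = (\<Sum>k<r. \<Sum>i<m. \<Sum>j<m. const_poly (A k i * A k j) * (p i * p j))"
      unfolding q(2) by (intro sum.cong refl) (simp add: A power2_eq_square sum_product const_poly_mult ac_simps)
    also have "\<dots> = (\<Sum>i<m. \<Sum>k<r. \<Sum>j<m. const_poly (A k i * A k j) * (p i * p j))"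
      by (rule sum.swap)
    also have "\<dots> = (\<Sum>i<m. \<Sum>j<m. \<Sum>k<r. const_poly (A k i * A k j) * (p i * p j))"
      by (intro sum.cong refl sum.swap)
    also have "\<dots> = (\<Sum>i<m. \<Sum>j<m. const_poly (\<Sum>k<r. A k i * A k j) * (p i * p j))"
      by (simp add: const_poly_sum sum_distrib_right)
    finally have 1: "?f = (\<Sum>i<m. \<Sum>j<m. const_poly (\<Sum>k<r. A k i * A k j) * (p i * p j))" .
    have 2: "(\<Sum>i<m. \<Sum>j<m. const_poly (unit_vec i j) * (p i * p j)) = ?f"
      by (intro sum.cong) (auto simp: unit_vec_def power2_eq_square if_distrib if_distribR cong: if_cong)
    have 3: "(\<Sum>i<m. \<Sum>j<m. const_poly (G i j) * (p i * p j)) = 0"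
      using 1 2 by (simp add: G_def single_diff left_diff_distrib sum_subtractf)
    have double: "2 * const_poly x = (const_poly (2 * x) :: nat mpoly)" for x
      by (simp only: mult_2 single_add)
    have Gsym: "G i j = G j i" for i j by (simp add: G_def unit_vec_def mult.commute)
    then have "(\<Sum>i<m. \<Sum>j<m. const_poly (G i j) * (p i * p j))
        = (\<Sum>(i, j)\<in>index_pairs m. if i = j then const_poly (G i j) * (p i * p j)
            else 2 * (const_poly (G i j) * (p i * p j)))"
      by (intro sum_symmetric_index_pairs) (simp add: mult.commute)
    also have "\<dots> = (\<Sum>k\<in>index_pairs m. mpoly_scale (case k of (i, j) \<Rightarrow> if i = j then G i j else 2 * G i j)
        (case k of (i, j) \<Rightarrow> p i * p j))"
      by (intro sum.cong) (auto simp: mpoly_scale_def simp flip: double)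
    finally have rel: "(\<Sum>k\<in>index_pairs m. mpoly_scale (case k of (i, j) \<Rightarrow> if i = j then G i j else 2 * G i j)
        (case k of (i, j) \<Rightarrow> p i * p j)) = 0" using 3 by simp
    have le: "G i j = 0" if "i \<le> j" "j < m" for i j
      using indep[THEN spec, THEN mp, OF rel, THEN bspec, of "(i, j)"] that by (simp add: index_pairs_def split: if_splits)
    have "G i j = 0" if "i < m" "j < m" for i j
      using le[of i j] le[of j i] Gsym[of i j] that by (cases "i \<le> j") auto
    then show "m \<le> r" by (intro orthonormal_columns_le_rows[where A = A]) (simp add: G_def)
  qed
  then show "m \<le> sos_length n d ?f"
    unfolding sos_length_def using LeastI[of "is_sos_of_length n d ?f", OF sos] by blast
qed

lemma subset_zero_if_dim_zero:
  fixes V :: "'v mpoly set"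
  assumes "finite T" "V \<subseteq> mpoly.span T" "mpoly.dim V = 0"
  shows "V \<subseteq> {0}"
proof -
  obtain B where B: "B \<subseteq> V" "mpoly.independent B" "V \<subseteq> mpoly.span B" "card B = mpoly.dim V"
    by (rule mpoly.basis_exists)
  then have "finite B" using card_le_dim_of_independent assms(1,2) by blast
  then have "B = {}" using B assms(3) by simp
  then show ?thesis using B by simp
qed

lemma le_if_Suc_choose_two_le:
  assumes "Suc k choose 2 \<le> Suc l choose 2"
  shows "k \<le> l"
proof (rule ccontr)
  assume "\<not> k \<le> l"
  then have "Suc (Suc l) choose 2 \<le> Suc k choose 2" by (intro binomial_right_mono) simp
  then show False using assms by (simp add: numeral_2_eq_2)
qed

text \<open>The basis size \<open>m\<close> is at most \<open>m'\<close> by the choice of points.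
  Conversely, the products indexed by \<open>index_pairs m\<close> span a space containing
  \<open>W\<close>, whose dimension is \<open>Suc m' choose 2\<close>, so \<open>m' \<le> m\<close>.
  The same count rules out relations among the products.\<close>

lemma sos_form_of_large_length:
  assumes n: "1 \<le> n" and d: "1 \<le> d" and s: "num_forms n (d - 1) \<le> s"
    and gen: "for_general_points n s (\<lambda>Z. int (hilbert_function n
      (ideal_prod (mpoly_ring n) (vanishing_ideal n Z) (vanishing_ideal n Z)) (2 * d))
      = int (num_forms n (2 * d)) - int ((num_forms n d - s + 1) choose 2))"
  shows "\<exists>f\<in>sos_forms n d. num_forms n d - s \<le> sos_length n d f"
proof -
  define m' where "m' = num_forms n d - s"
  obtain X Z where hilb: "int (hilbert_function n
      (ideal_prod (mpoly_ring n) (vanishing_ideal n Z) (vanishing_ideal n Z)) (2 * d))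
      = int (num_forms n (2 * d)) - int ((num_forms n d - s + 1) choose 2)"
    and X: "X \<subseteq> \<Union>Z"
    and dimV: "mpoly.dim (vanishing_forms n d X) \<le> num_forms n d - s"
    and dim0: "mpoly.dim (vanishing_forms n (d - 1) X) \<le> num_forms n (d - 1) - s"
    using general_points_with_small_vanishing_forms[OF n d gen] .
  \<comment> \<open>There are at least as many points as the dimension of the forms of degree
    \<open>d - 1\<close>, so the truncated difference is 0.\<close>
  have dim0': "mpoly.dim (vanishing_forms n (d - 1) X) = 0" using dim0 s by simp
  have fin: "\<exists>T. finite T \<and> forms n e \<subseteq> mpoly.span T" for e
    using forms_finite_span[OF n, of e] by blast
  have vf: "vanishing_forms n e X \<subseteq> forms n e" for e by (auto simp: vanishing_forms_def)
  have low0: "vanishing_forms n (d - 1) X \<subseteq> {0}"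
    using subset_zero_if_dim_zero[OF _ _ dim0'] fin[of "d - 1"] vf[of "d - 1"] by blast
  have low: "vanishing_forms n e X \<subseteq> {0}" if "e < d" for e
    using vanishing_forms_lower_degree[OF n, of e "d - 1 - e" X] low0 that by simp
  define V where "V = vanishing_forms n d X"
  define W where "W = ideal_prod (mpoly_ring n) (vanishing_ideal n Z) (vanishing_ideal n Z) \<inter> forms n (2 * d)"
  obtain T where T: "finite T" "forms n (2 * d) \<subseteq> mpoly.span T" using fin by blast
  have W: "mpoly.subspace W" "W \<subseteq> forms n (2 * d)"
    unfolding W_def by (rule subspace_square_of_vanishing_ideal) auto
  have "quotient_dim (forms n (2 * d)) W = num_forms n (2 * d) - mpoly.dim W"
    using quotient_dim_eq[OF W(1) subspace_forms W(2) T] by (simp add: dim_forms[OF n])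
  \<comment> \<open>This makes the subtraction of natural numbers in the quotient dimension exact,
    so that it can be compared with the integer equation \<open>hilb\<close>.\<close>
  moreover have "mpoly.dim W \<le> num_forms n (2 * d)"
  proof -
    obtain A where A: "A \<subseteq> W" "mpoly.independent A" "card A = mpoly.dim W"
      by (rule mpoly.basis_exists)
    then show ?thesis
      using card_le_dim_of_independent[OF A(2) _ T] W(2) by (simp add: dim_forms[OF n])
  qed
  ultimately have dimW: "mpoly.dim W = Suc m' choose 2"
    using hilb by (simp add: hilbert_function_def W_def m'_def)
  obtain B where B: "B \<subseteq> V" "mpoly.independent B" "V \<subseteq> mpoly.span B" "card B = mpoly.dim V"
    by (rule mpoly.basis_exists)
  have finB: "finite B"
    using card_le_dim_of_independent[OF B(2,1)] fin[of d] vf[of d] unfolding V_def by blast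
  define m where "m = card B"
  obtain p where p: "bij_betw p {..<m} B"
    using ex_bij_betw_nat_finite[OF finB] unfolding m_def atLeast0LessThan by blast
  have pB: "p ` {..<m} = B" using p by (rule bij_betw_imp_surj_on)
  have mm': "m \<le> m'" using dimV B(4) by (simp add: m_def m'_def V_def)
  have prods: "{f * g |f g. f \<in> V \<and> g \<in> V} \<subseteq> mpoly.span ((\<lambda>(i, j). p i * p j) ` index_pairs m)"
  proof safe
    fix f g assume "f \<in> V" "g \<in> V"
    then have fg: "f \<in> mpoly.span (p ` {..<m})" "g \<in> mpoly.span (p ` {..<m})"
      using B(3) pB by auto
    obtain a where a: "f = (\<Sum>i<m. const_poly (a i) * p i)"
      using span_image_combination[OF finite_lessThan fg(1)] .
    obtain b where b: "g = (\<Sum>i<m. const_poly (b i) * p i)"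
      using span_image_combination[OF finite_lessThan fg(2)] .
    have pp: "p i * p j \<in> (\<lambda>(i, j). p i * p j) ` index_pairs m" if "i < m" "j < m" for i j
    proof (cases "i \<le> j")
      case True
      then show ?thesis using that by (intro image_eqI[of _ _ "(i, j)"]) (auto simp: index_pairs_def)
    next
      case False
      then show ?thesis using that
        by (intro image_eqI[of _ _ "(j, i)"]) (auto simp: index_pairs_def mult.commute)
    qed
    have "(\<Sum>i<m. \<Sum>j<m. mpoly_scale (a i * b j) (p i * p j))
        \<in> mpoly.span ((\<lambda>(i, j). p i * p j) ` index_pairs m)"
      by (intro mpoly.span_sum mpoly.span_scale mpoly.span_base pp) simp_all
    moreover have "const_poly (a i) * p i * (const_poly (b j) * p j) = mpoly_scale (a i * b j) (p i * p j)" for i j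
      by (simp add: mpoly_scale_def const_poly_mult ac_simps)
    then have "f * g = (\<Sum>i<m. \<Sum>j<m. mpoly_scale (a i * b j) (p i * p j))"
      by (simp only: a b sum_product)
    ultimately show "f * g \<in> mpoly.span ((\<lambda>(i, j). p i * p j) ` index_pairs m)" by simp
  qed
  have "W \<subseteq> mpoly.span {f * g |f g. f \<in> V \<and> g \<in> V}"
    unfolding W_def V_def by (rule square_of_vanishing_ideal_subset[OF X low])
  also have "\<dots> \<subseteq> mpoly.span ((\<lambda>(i, j). p i * p j) ` index_pairs m)"
    by (rule mpoly.span_minimal[OF prods mpoly.subspace_span])
  finally have Wspan: "W \<subseteq> mpoly.span ((\<lambda>(i, j). p i * p j) ` index_pairs m)" .
  have card: "card (index_pairs m) \<le> mpoly.dim W"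
    unfolding card_index_pairs dimW using mm' by (intro binomial_right_mono) simp
  have "mpoly.dim W \<le> card ((\<lambda>(i, j). p i * p j) ` index_pairs m)"
    by (intro mpoly.dim_le_card Wspan finite_imageI finite_index_pairs)
  also have "\<dots> \<le> card (index_pairs m)" by (intro card_image_le finite_index_pairs)
  finally have m'm: "m' \<le> m"
    unfolding card_index_pairs dimW by (rule le_if_Suc_choose_two_le)
  have pV: "p i \<in> vanishing_forms n d X" if "i < m" for i
    using pB B(1) that by (auto simp: V_def)
  have Vspan: "vanishing_forms n d X \<subseteq> mpoly.span (p ` {..<m})" using B(3) by (simp add: pB V_def)
  have "\<forall>c. (\<Sum>k\<in>index_pairs m. mpoly_scale (c k) (case k of (i, j) \<Rightarrow> p i * p j)) = 0 \<longrightarrow>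
      (\<forall>k\<in>index_pairs m. c k = 0)"
    using trivial_relations_if_card_le_dim[OF finite_index_pairs Wspan card] by blast
  note bound = sos_length_lower_bound[OF pV Vspan this]
  have "num_forms n d - s \<le> sos_length n d (\<Sum>i<m. (p i)\<^sup>2)"
    using m'm bound(2) by (simp add: m'_def)
  with bound(1) show ?thesis by blast
qed

section \<open>Asymptotics\<close>

text \<open>The binomial coefficient is a polynomial in \<open>d\<close> of degree \<open>q\<close>.
  Passing from \<open>q\<close> to \<open>Suc q\<close> multiplies it by
  \<open>(k * d + Suc q) / Suc q\<close>, which after division by \<open>d\<close> tends to
  \<open>k / Suc q\<close>.\<close>

lemma binomial_over_power_tendsto:
  "(\<lambda>d. real ((k * d + q) choose q) / real d ^ q) \<longlonglongrightarrow> real k ^ q / fact q"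
proof (induction q)
  case (Suc q)
  have "(\<lambda>d. (real k + real (Suc q) / real d) / real (Suc q)) \<longlonglongrightarrow> (real k + 0) / real (Suc q)"
    by (intro tendsto_intros lim_const_over_n) simp
  from tendsto_mult[OF this Suc.IH]
  have lim: "(\<lambda>d. (real k + real (Suc q) / real d) / real (Suc q) * (real ((k * d + q) choose q) / real d ^ q))
      \<longlonglongrightarrow> real k ^ Suc q / fact (Suc q)"
    by (simp add: field_simps)
  have "\<forall>\<^sub>F d in sequentially.
      (real k + real (Suc q) / real d) / real (Suc q) * (real ((k * d + q) choose q) / real d ^ q)
      = real ((k * d + Suc q) choose Suc q) / real d ^ Suc q"
    using eventually_gt_at_top[of 0]
  proof eventually_elim
    case (elim d)
    have "real (Suc (k * d + q)) * real ((k * d + q) choose q)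
        = real (Suc (k * d + q) choose Suc q) * real (Suc q)"
      using Suc_times_binomial_eq[of "k * d + q" q] by (metis of_nat_mult)
    then have "real (Suc (k * d + q) choose Suc q)
        = real (Suc (k * d + q)) * real ((k * d + q) choose q) / real (Suc q)"
      by (simp add: eq_divide_eq del: binomial_Suc_Suc)
    moreover have "real k + real (Suc q) / real d = real (Suc (k * d + q)) / real d"
      using elim by (simp add: field_simps)
    ultimately show ?case by (simp del: binomial_Suc_Suc of_nat_Suc)
  qed
  then show ?case using lim by (rule Lim_transform_eventually[rotated])
qed simp

lemma num_forms_over_power_tendsto:
  assumes "1 \<le> n"
  shows "(\<lambda>d. real (num_forms n (k * d)) / real d ^ (n - 1)) \<longlonglongrightarrow> real k ^ (n - 1) / fact (n - 1)"
proof -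
  have "num_forms n e = (e + (n - 1)) choose (n - 1)" for e
    using assms by (simp add: num_forms_def add.commute)
  then show ?thesis using binomial_over_power_tendsto[of k "n - 1"] by simp
qed

lemma powr_filterlim_at_top:
  fixes a :: real
  assumes "0 < a"
  shows "filterlim (\<lambda>d. real d powr a) at_top sequentially"
  using assms by real_asymp

text \<open>Pascal's rule: a monomial either contains a chosen variable or lives in the others. It
  turns s >= N_{d-1} into the bound m <= N_{n-1,d}.\<close>

lemma num_forms_diff:
  assumes "2 \<le> n" "1 \<le> d"
  shows "num_forms n d = num_forms n (d - 1) + num_forms (n - 1) d"
proof -
  obtain k e where "n = Suc (Suc k)" "d = Suc e"
    using assms by (metis One_nat_def Suc_le_D numeral_2_eq_2 Suc_le_mono)
  then show ?thesis by (simp add: num_forms_def)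
qed

section \<open>Bounds for p(n,2d) in a fixed degree\<close>

text \<open>Every length l satisfies l^2 <= l(l+1) <= 2 N_{2d}. The supremum is therefore finite and
  \<open>the_enat\<close> returns its true value.\<close>

lemma pythagoras_finite_upper_bound:
  assumes "1 \<le> n"
  shows "\<exists>p. pythagoras n d = enat p \<and> real p \<le> sqrt (2 * real (num_forms n (2 * d)))"
proof -
  define b where "b = sqrt (2 * real (num_forms n (2 * d)))"
  have "real (sos_length n d f) \<le> b" if "f \<in> sos_forms n d" for f
  proof -
    define l where "l = sos_length n d f"
    have "2 * (Suc l choose 2) = Suc l * l"
      by (simp add: choose_two)
    then have "l * l \<le> 2 * num_forms n (2 * d)"
      using sos_length_upper_bound[OF assms that] by (simp add: l_def)
    then have "(real l)\<^sup>2 \<le> 2 * real (num_forms n (2 * d))"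
      unfolding power2_eq_square by (metis of_nat_le_iff of_nat_mult of_nat_numeral)
    then show ?thesis unfolding b_def l_def by (rule real_le_rsqrt)
  qed
  then have "sos_length n d f \<le> nat \<lfloor>b\<rfloor>" if "f \<in> sos_forms n d" for f
    using that by (simp add: le_nat_floor)
  then have le: "pythagoras n d \<le> enat (nat \<lfloor>b\<rfloor>)"
    unfolding pythagoras_def by (intro SUP_least) simp
  then obtain p where p: "pythagoras n d = enat p" by (cases "pythagoras n d") auto
  then have "real p \<le> real (nat \<lfloor>b\<rfloor>)" using le by simp
  also have "\<dots> \<le> b" by (simp add: b_def)
  finally show ?thesis using p by (simp add: b_def)
qed

text \<open>Having n N_d instead of n s in \<open>big\<close> frees the inequality from s and still
  puts the maximum at its second entry. All exceptional triples have degree parameter 2, which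
  \<open>3 \<le> d\<close> avoids, and \<open>1 \<le> m\<close> gives s < N_d.\<close>

lemma pythagoras_lower_bound:
  assumes conj: "iarrobino_kanev_conjecture" and n: "3 \<le> n" and d: "3 \<le> d"
    and m: "1 \<le> m" "m + num_forms n (d - 1) \<le> num_forms n d"
    and big: "n * num_forms n d + (Suc m choose 2) \<le> num_forms n (2 * d)"
  shows "enat m \<le> pythagoras n d"
proof -
  define s where "s = num_forms n d - m"
  have s: "num_forms n (d - 1) \<le> s" "s < num_forms n d" and ms: "num_forms n d - s = m"
    using m by (auto simp: s_def)
  have "n * s \<le> n * num_forms n d" using s by simp
  then have "int (n * s) + int (Suc m choose 2) \<le> int (num_forms n (2 * d))" using big by linarith
  moreover have "(n, d, s) \<notin> {(3, 2, 5), (4, 2, 9), (5, 2, 14)}" using d by auto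
  ultimately have ik_value: "iarrobino_kanev_value n d s
      = int (num_forms n (2 * d)) - int ((num_forms n d - s + 1) choose 2)"
    unfolding iarrobino_kanev_value_def Let_def ms by (simp only: if_False) simp
  have "2 \<le> d" using d by simp
  have "for_general_points n s (\<lambda>Z. int (hilbert_function n
      (ideal_prod (mpoly_ring n) (vanishing_ideal n Z) (vanishing_ideal n Z)) (2 * d))
      = int (num_forms n (2 * d)) - int ((num_forms n d - s + 1) choose 2))"
    using conj[unfolded iarrobino_kanev_conjecture_def, rule_format, OF n \<open>2 \<le> d\<close> s]
    by (simp only: ik_value)
  then obtain f where f: "f \<in> sos_forms n d" "num_forms n d - s \<le> sos_length n d f"
    using sos_form_of_large_length[OF _ _ s(1)] n d by auto
  then have "enat m \<le> enat (sos_length n d f)" using ms by simp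
  also have "\<dots> \<le> pythagoras n d" unfolding pythagoras_def using f(1) by (rule SUP_upper)
  finally show ?thesis .
qed

section \<open>Passage to large degrees\<close>

lemma powr_half_square:
  assumes "1 \<le> n" "0 < d"
  shows "real d powr ((real n - 1) / 2) * real d powr ((real n - 1) / 2) = real d ^ (n - 1)"
  using assms by (simp add: powr_realpow[symmetric] of_nat_diff flip: powr_add)

lemma eventually_pythagoras_upper:
  assumes n: "1 \<le> n" and e: "0 < \<epsilon>"
  shows "\<forall>\<^sub>F d in sequentially. real (the_enat (pythagoras n d))
    < (sqrt (2 ^ n / fact (n - 1)) + \<epsilon>) * real d powr ((real n - 1) / 2)"
proof -
  let ?C = "sqrt (2 ^ n / fact (n - 1))"
  have "(\<lambda>d. sqrt (2 * (real (num_forms n (2 * d)) / real d ^ (n - 1))))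
      \<longlonglongrightarrow> sqrt (2 * (real 2 ^ (n - 1) / fact (n - 1)))"
    by (intro tendsto_intros num_forms_over_power_tendsto n)
  also have "2 * (real 2 ^ (n - 1) / fact (n - 1)) = 2 ^ n / fact (n - 1)"
    using n by (simp add: power_eq_if)
  finally have "\<forall>\<^sub>F d in sequentially. sqrt (2 * (real (num_forms n (2 * d)) / real d ^ (n - 1))) < ?C + \<epsilon>"
    using e by (intro order_tendstoD(2)) auto
  then show ?thesis
    using eventually_gt_at_top[of 0]
  proof eventually_elim
    case (elim d)
    define y where "y = real d powr ((real n - 1) / 2)"
    have y: "y > 0" "y * y = real d ^ (n - 1)" using elim powr_half_square[OF n] by (auto simp: y_def)
    obtain p where p: "pythagoras n d = enat p" "real p \<le> sqrt (2 * real (num_forms n (2 * d)))"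
      using pythagoras_finite_upper_bound[OF n] by blast
    have "sqrt (2 * real (num_forms n (2 * d)))
        = sqrt (2 * (real (num_forms n (2 * d)) / real d ^ (n - 1)) * (y * y))"
      using elim y by simp
    also have "\<dots> = sqrt (2 * (real (num_forms n (2 * d)) / real d ^ (n - 1))) * y"
      unfolding real_sqrt_mult[of _ "y * y"] using y(1) by simp
    also have "\<dots> < (?C + \<epsilon>) * y" using elim y by (intro mult_strict_right_mono) auto
    finally show ?case using p by (simp add: y_def)
  qed
qed

text \<open>The number m is \<open>x * y d\<close> rounded down, which costs the 1. The lower bound
  in degree d applies once m is at least 1, below N_{n-1,d}, and small enough for
  \<open>big\<close>; the facts \<open>ev1\<close>, \<open>ev2\<close> and \<open>ev3\<close>
  provide this for large d.\<close>

lemma eventually_pythagoras_lower: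
  assumes conj: "iarrobino_kanev_conjecture" and n: "4 \<le> n"
    and x: "0 < x" "x < sqrt ((2 ^ n - 2 * real n) / fact (n - 1))"
  shows "\<forall>\<^sub>F d in sequentially.
    x * real d powr ((real n - 1) / 2) - 1 < real (the_enat (pythagoras n d))"
proof -
  define y where "y d = real d powr ((real n - 1) / 2)" for d :: nat
  have n1: "1 \<le> n" using n by simp
  have y2: "y d * y d = real d ^ (n - 1)" if "0 < d" for d
    using powr_half_square[OF n1 that] by (simp add: y_def)
  have ypos: "y d > 0" if "0 < d" for d using that by (simp add: y_def)
  have ytop: "filterlim y at_top sequentially"
    unfolding y_def using n by (intro powr_filterlim_at_top) simp
  have "\<forall>\<^sub>F d in sequentially. y d \<ge> 1 / x"
    using ytop by (simp add: filterlim_at_top)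
  then have ev1: "\<forall>\<^sub>F d in sequentially. 1 \<le> x * y d"
    by eventually_elim (use x in \<open>simp add: field_simps\<close>)
  have ev2: "\<forall>\<^sub>F d in sequentially. x * y d < real (num_forms (n - 1) d)"
  proof -
    \<comment> \<open>The exponent is (n - 1)/2 - (n - 2), the growth of m relative to N_{n-1,d}; it
      is negative because n >= 4.\<close>
    have "(\<lambda>d. real d powr (- (real n - 3) / 2)) \<longlonglongrightarrow> 0"
      using n by (intro tendsto_neg_powr filterlim_real_sequentially) simp
    then have l0: "(\<lambda>d. x * real d powr (- (real n - 3) / 2)) \<longlonglongrightarrow> x * 0"
      by (intro tendsto_intros)
    have l1: "(\<lambda>d. real (num_forms (n - 1) (1 * d)) / real d ^ (n - 1 - 1))
        \<longlonglongrightarrow> real 1 ^ (n - 1 - 1) / fact (n - 1 - 1)"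
      using n by (intro num_forms_over_power_tendsto) simp
    have "\<forall>\<^sub>F d in sequentially. x * real d powr (- (real n - 3) / 2)
        - real (num_forms (n - 1) (1 * d)) / real d ^ (n - 1 - 1) < 0"
      using tendsto_diff[OF l0 l1] by (rule order_tendstoD) simp
    then show ?thesis
      using eventually_gt_at_top[of 0]
    proof eventually_elim
      case (elim d)
      have "real d ^ (n - 1 - 1) = real d powr (real n - 2)"
        using n elim by (simp add: powr_realpow[symmetric] of_nat_diff)
      then have "y d = real d powr (- (real n - 3) / 2) * real d ^ (n - 1 - 1)"
        by (simp add: y_def field_simps flip: powr_add)
      then have "x * y d = x * real d powr (- (real n - 3) / 2) * real d ^ (n - 1 - 1)" by simp
      also have "\<dots> < real (num_forms (n - 1) (1 * d)) / real d ^ (n - 1 - 1) * real d ^ (n - 1 - 1)"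
        using elim by (intro mult_strict_right_mono) auto
      finally show ?case using elim by simp
    qed
  qed
  have ev3: "\<forall>\<^sub>F d in sequentially.
      real n * real (num_forms n d) + (x * y d + 1) * (x * y d) / 2 < real (num_forms n (2 * d))"
  proof -
    have inv: "(\<lambda>d. inverse (y d)) \<longlonglongrightarrow> 0"
      using ytop by (rule tendsto_inverse_0_at_top)
    \<comment> \<open>The desired inequality divided by d^(n-1), which is
      \<open>y d * y d\<close>.\<close>
    have "(\<lambda>d. real n * (real (num_forms n (1 * d)) / real d ^ (n - 1))
          + (x + inverse (y d)) * x / 2 - real (num_forms n (2 * d)) / real d ^ (n - 1))
        \<longlonglongrightarrow> real n * (real 1 ^ (n - 1) / fact (n - 1)) + (x + 0) * x / 2 - real 2 ^ (n - 1) / fact (n - 1)"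
      by (intro tendsto_intros num_forms_over_power_tendsto n1 inv) simp_all
    \<comment> \<open>With c_n the lower constant, this limit is (x^2 - c_n^2)/2.\<close>
    moreover have "real n * (real 1 ^ (n - 1) / fact (n - 1)) + (x + 0) * x / 2 - real 2 ^ (n - 1) / fact (n - 1) < 0"
    proof -
      have "sqrt ((2 ^ n - 2 * real n) / fact (n - 1)) > 0" using x by linarith
      then have "x * x < (2 ^ n - 2 * real n) / fact (n - 1)"
        using x mult_strict_mono[OF x(2) x(2)] by simp
      also have "\<dots> = 2 * (2 ^ (n - 1) / fact (n - 1)) - 2 * (real n * (1 / fact (n - 1)))"
        using n by (simp add: power_eq_if diff_divide_distrib)
      finally show ?thesis by simp
    qed
    ultimately have "\<forall>\<^sub>F d in sequentially. real n * (real (num_forms n (1 * d)) / real d ^ (n - 1))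
          + (x + inverse (y d)) * x / 2 - real (num_forms n (2 * d)) / real d ^ (n - 1) < 0"
      by (rule order_tendstoD)
    then show ?thesis
      using eventually_gt_at_top[of 0]
    proof eventually_elim
      case (elim d)
      define D where "D = real d ^ (n - 1)"
      have D: "D > 0" "D = y d * y d" using elim y2[of d] by (auto simp: D_def)
      have "(real n * (real (num_forms n d) / D) + (x + inverse (y d)) * x / 2
          - real (num_forms n (2 * d)) / D) * D < 0"
        using elim D(1) by (intro mult_neg_pos) (auto simp: D_def)
      also have "(real n * (real (num_forms n d) / D) + (x + inverse (y d)) * x / 2
          - real (num_forms n (2 * d)) / D) * D
          = real n * real (num_forms n d) + (x + inverse (y d)) * x / 2 * D - real (num_forms n (2 * d))"
        using D(1) by (simp add: algebra_simps)
      also have "(x + inverse (y d)) * x / 2 * D = (x * y d + 1) * (x * y d) / 2"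
        using ypos[of d] elim unfolding D(2) by (simp add: field_simps)
      finally show ?case by simp
    qed
  qed
  show ?thesis
    using ev1 ev2 ev3 eventually_ge_at_top[of 3]
  proof eventually_elim
    case (elim d)
    define m where "m = nat \<lfloor>x * y d\<rfloor>"
    have m: "1 \<le> m" "real m \<le> x * y d" "x * y d - 1 < real m"
      using elim(1) by (auto simp: m_def le_nat_floor)
    have "enat m \<le> pythagoras n d"
    proof (rule pythagoras_lower_bound[OF conj _ elim(4) m(1)])
      have "real m < real (num_forms (n - 1) d)" using m(2) elim(2) by linarith
      then show "m + num_forms n (d - 1) \<le> num_forms n d"
        using num_forms_diff[of n d] n elim(4) by simp
      have "2 * (Suc m choose 2) = Suc m * m" by (simp add: choose_two)
      then have "2 * real (Suc m choose 2) = real (Suc m) * real m"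
        by (metis of_nat_mult of_nat_numeral)
      moreover have "real (Suc m) * real m \<le> (x * y d + 1) * (x * y d)"
        using m(2) elim(1) by (intro mult_mono) auto
      ultimately have "real n * real (num_forms n d) + real (Suc m choose 2) < real (num_forms n (2 * d))"
        using elim(3) by linarith
      then have "real (n * num_forms n d + (Suc m choose 2)) < real (num_forms n (2 * d))" by simp
      then show "n * num_forms n d + (Suc m choose 2) \<le> num_forms n (2 * d)"
        unfolding of_nat_less_iff by simp
    qed (use n in simp)
    moreover obtain p where "pythagoras n d = enat p" using pythagoras_finite_upper_bound[OF n1] by blast
    ultimately have "real m \<le> real (the_enat (pythagoras n d))" by simp
    then show ?case using m(3) unfolding y_def by linarith
  qed
qed

text \<open>This makes the lower constant positive.\<close>

lemma two_n_less_power: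
  assumes "4 \<le> n"
  shows "2 * n < 2 ^ n"
  using assms by (induction n rule: dec_induct) auto

theorem theorem3p13:
  fixes n :: nat and c C :: real
  assumes "4 \<le> n"
    and "iarrobino_kanev_conjecture"
  defines "c \<equiv> sqrt ((2 ^ n - 2 * real n) / fact (n - 1))"
    and "C \<equiv> sqrt (2 ^ n / fact (n - 1))"
  shows "(\<lambda>d. real (the_enat (pythagoras n d))) \<in> \<Theta>(\<lambda>d. real d powr ((real n - 1) / 2)) \<and>
    (\<forall>\<epsilon>>0. finite {d. 0 < d \<and>
       \<not> (ereal ((c - \<epsilon>) * real d powr ((real n - 1) / 2)) < ereal_of_enat (pythagoras n d) \<and>
          ereal_of_enat (pythagoras n d) < ereal ((C + \<epsilon>) * real d powr ((real n - 1) / 2)))})"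
proof -
  define y where "y d = real d powr ((real n - 1) / 2)" for d :: nat
  define p where "p d = real (the_enat (pythagoras n d))" for d
  have n1: "1 \<le> n" using assms(1) by simp
  have enat: "ereal_of_enat (pythagoras n d) = ereal (p d)" for d
    using pythagoras_finite_upper_bound[OF n1, of d] by (auto simp: p_def)
  have "real (2 * n) < real (2 ^ n)"
    using two_n_less_power[OF assms(1)] unfolding of_nat_less_iff .
  then have c: "0 < c" by (simp add: c_def)
  have ytop: "filterlim y at_top sequentially"
    unfolding y_def using assms(1) by (intro powr_filterlim_at_top) simp
  have upper: "\<forall>\<^sub>F d in sequentially. p d < (C + \<epsilon>) * y d" if "\<epsilon> > 0" for \<epsilon>
    using eventually_pythagoras_upper[OF n1 that] by (simp add: p_def y_def C_def)
  have lower: "\<forall>\<^sub>F d in sequentially. (c - \<epsilon>) * y d < p d" if e: "\<epsilon> > 0" for \<epsilon>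
  proof -
    \<comment> \<open>The maximum with \<open>c / 2\<close> keeps \<open>x\<close> positive for
      large \<open>\<epsilon>\<close>. The gap between \<open>c - \<epsilon>\<close> and
      \<open>x\<close>, multiplied by \<open>y d\<close>, eventually absorbs the 1 lost by
      rounding.\<close>
    define x where "x = max (c - \<epsilon> / 2) (c / 2)"
    have x: "0 < x" "x < c" "c - \<epsilon> < x" using c e by (auto simp: x_def)
    have "\<forall>\<^sub>F d in sequentially. x * y d - 1 < p d"
      using eventually_pythagoras_lower[OF assms(2,1) x(1) x(2)[unfolded c_def]]
      by (simp add: p_def y_def)
    moreover have "\<forall>\<^sub>F d in sequentially. 1 / (x - (c - \<epsilon>)) \<le> y d"
      using ytop by (simp add: filterlim_at_top)
    ultimately show ?thesis
    proof eventually_elim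
      case (elim d)
      have "1 \<le> y d * (x - (c - \<epsilon>))" using elim(2) x(3) by (simp add: divide_le_eq)
      then show ?case using elim(1) by (simp add: algebra_simps)
    qed
  qed
  have "p \<in> \<Theta>(y)"
  proof (rule bigthetaI)
    show "p \<in> O(y)"
      using upper[of 1] by (intro bigoI[of _ "C + 1"]) (auto elim!: eventually_mono simp: p_def y_def)
    have "y \<in> O(p)"
    \<comment> \<open>The lower bound with \<open>\<epsilon> = c / 2\<close> leaves the factor
      \<open>c / 2\<close>, whose reciprocal is the constant.\<close>
    proof (rule bigoI[of _ "2 / c"])
      show "\<forall>\<^sub>F d in sequentially. norm (y d) \<le> 2 / c * norm (p d)"
        using lower[of "c / 2"] c
        by (auto elim!: eventually_mono simp: p_def y_def field_simps)
    qed
    then show "p \<in> \<Omega>(y)" by (simp add: bigomega_iff_bigo)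
  qed
  moreover have "finite {d. 0 < d \<and> \<not> (ereal ((c - \<epsilon>) * y d) < ereal (p d) \<and> ereal (p d) < ereal ((C + \<epsilon>) * y d))}"
    if eps: "\<epsilon> > 0" for \<epsilon>
  proof -
    obtain N where "\<forall>d\<ge>N. (c - \<epsilon>) * y d < p d \<and> p d < (C + \<epsilon>) * y d"
      using eventually_conj[OF lower[OF eps] upper[OF eps]] by (auto simp: eventually_sequentially)
    then have "{d. 0 < d \<and> \<not> (ereal ((c - \<epsilon>) * y d) < ereal (p d) \<and> ereal (p d) < ereal ((C + \<epsilon>) * y d))} \<subseteq> {..<N}"
      by (auto simp: not_less[symmetric])
    then show ?thesis by (rule finite_subset) simp
  qed
  ultimately show ?thesis
    unfolding enat unfolding p_def y_def by blast
qed

end
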